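(* Let $\lambda$ be a set partition of $\{1,\ldots,21\}$ into six blocks of sizes $4,4,4,3,3,3$, and let $\mathsf{M}$ be the matroid arising from $\lambda$. Then the normalized inverse Kazhdan–Lusztig polynomial $\mathcal{B}(Q_{\mathsf{M}})(x)$ is not real-rooted.
   Context: The matroid arising from a set partition $\lambda$ of $[n]$ is the dual of the loopless rank-$2$ matroid on $[n]$ whose rank-$1$ flats are exactly the blocks of $\lambda$ (so here $\mathsf{M}$ has rank $19$). $\mu(\mathsf{N})$ is the Möbius value $\mu(\varnothing,E)$ of the lattice of flats $\mathcal{L}(\mathsf{N})$. The inverse Kazhdan–Lusztig polynomial $Q_{\mathsf{N}}$ is the unique assignment to loopless matroids with $Q_{\mathsf{N}}=1$ in rank $0$, $\deg Q_{\mathsf{N}}<\operatorname{rk}(\mathsf{N})/2$ in positive rank, and $\sum_{F}(-1)^{\operatorname{rk}\mathsf{N}-\operatorname{rk}F}\mu(\mathsf{N}/F)x^{\operatorname{rk}\mathsf{N}-\operatorname{rk}F}Q_{\mathsf{N}|_F}(x)$ palindromic of degree $\operatorname{rk}\mathsf{N}$. If $Q_{\mathsf{M}}(x)=\sum_{j=0}^sq_jx^j$ with $s=\deg Q_{\mathsf{M}}$, then $\mathcal{B}(Q_{\mathsf{M}})(x)=\sum_{j=0}^s\binom{s}{j}q_jx^j$. A polynomial is real-rooted if all its complex roots are real. *)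

theory Defs
  imports
    Complex_Main
    "HOL-Library.Multiset"
    "HOL-Library.Disjoint_Sets"
    "HOL-Computational_Algebra.Polynomial"
begin

section \<open>Matroids\<close>

record 'a indep_system =
  ground :: "'a set"
  indeps :: "'a set set"

definition is_matroid :: "'a indep_system \<Rightarrow> bool" where
  "is_matroid M \<longleftrightarrow>
     finite (ground M) \<and> (\<forall>I\<in>indeps M. I \<subseteq> ground M) \<and> {} \<in> indeps M \<and>
     (\<forall>I\<in>indeps M. \<forall>J. J \<subseteq> I \<longrightarrow> J \<in> indeps M) \<and>
     (\<forall>I\<in>indeps M. \<forall>J\<in>indeps M. card I < card J \<longrightarrow> (\<exists>e\<in>J - I. insert e I \<in> indeps M))"

definition rk :: "'a indep_system \<Rightarrow> 'a set \<Rightarrow> nat" where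
  "rk M A = Max (card ` {I \<in> indeps M. I \<subseteq> A})"

definition matroid_rank :: "'a indep_system \<Rightarrow> nat" where
  "matroid_rank M = rk M (ground M)"

definition basis_of :: "'a indep_system \<Rightarrow> 'a set \<Rightarrow> 'a set \<Rightarrow> bool" where
  "basis_of M A B \<longleftrightarrow>
     B \<in> indeps M \<and> B \<subseteq> A \<and> (\<forall>I\<in>indeps M. B \<subseteq> I \<and> I \<subseteq> A \<longrightarrow> I = B)"

definition loopless :: "'a indep_system \<Rightarrow> bool" where
  "loopless M \<longleftrightarrow> (\<forall>e\<in>ground M. {e} \<in> indeps M)"

definition flats :: "'a indep_system \<Rightarrow> 'a set set" where
  "flats M = {F. F \<subseteq> ground M \<and> (\<forall>e\<in>ground M - F. rk M F < rk M (insert e F))}"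

definition matroid_restrict :: "'a indep_system \<Rightarrow> 'a set \<Rightarrow> 'a indep_system" where
  "matroid_restrict M A = \<lparr>ground = A, indeps = {I \<in> indeps M. I \<subseteq> A}\<rparr>"

definition matroid_contract :: "'a indep_system \<Rightarrow> 'a set \<Rightarrow> 'a indep_system" where
  "matroid_contract M A =
     \<lparr>ground = ground M - A,
      indeps = {I. I \<subseteq> ground M - A \<and> (\<exists>B. basis_of M A B \<and> I \<union> B \<in> indeps M)}\<rparr>"

definition matroid_dual :: "'a indep_system \<Rightarrow> 'a indep_system" where
  "matroid_dual M =
     \<lparr>ground = ground M,
      indeps = {I. I \<subseteq> ground M \<and> (\<exists>B. basis_of M (ground M) B \<and> I \<inter> B = {})}\<rparr>"

definition rank_two_matroid :: "'a set \<Rightarrow> 'a set set \<Rightarrow> 'a indep_system" where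
  "rank_two_matroid E P =
     (THE N. is_matroid N \<and> ground N = E \<and> loopless N \<and> matroid_rank N = 2 \<and>
             {F \<in> flats N. rk N F = 1} = P)"

definition partition_matroid_dual :: "'a set \<Rightarrow> 'a set set \<Rightarrow> 'a indep_system" where
  "partition_matroid_dual E P = matroid_dual (rank_two_matroid E P)"


section \<open>Inverse Kazhdan--Lusztig polynomials\<close>

text \<open>The Moebius function of a family \<open>L\<close> of finite sets, ordered by inclusion.\<close>

function moebius :: "'a set set \<Rightarrow> 'a set \<Rightarrow> 'a set \<Rightarrow> int" where
  "moebius L A B =
     (if A = B then 1
      else if A \<subset> B \<and> finite B then - (\<Sum>C\<in>{C \<in> L. A \<subseteq> C \<and> C \<subset> B}. moebius L A C)
      else 0)"
  by auto
termination
  by (relation "measure (\<lambda>(L, A, B). card B)") (auto intro: psubset_card_mono)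

declare moebius.simps [simp del]

definition matroid_moebius :: "'a indep_system \<Rightarrow> int" where
  "matroid_moebius M = moebius (flats M) {} (ground M)"

text \<open>
  Palindromic of degree \<open>d\<close> means $x^d p(1/x) = p(x)$. This only bounds the degree of \<open>p\<close> by
  \<open>d\<close>; in the sum below the coefficient of $x^d$ is the nonzero number $(-1)^d \mu(N)$.
\<close>

definition palindromic :: "nat \<Rightarrow> int poly \<Rightarrow> bool" where
  "palindromic d p \<longleftrightarrow> degree p \<le> d \<and> (\<forall>i\<le>d. coeff p i = coeff p (d - i))"

definition inverse_KL_sum :: "('a indep_system \<Rightarrow> int poly) \<Rightarrow> 'a indep_system \<Rightarrow> int poly" where
  "inverse_KL_sum Q N =
     (\<Sum>F\<in>flats N.
        monom ((-1) ^ (matroid_rank N - rk N F) * matroid_moebius (matroid_contract N F))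
          (matroid_rank N - rk N F)
        * Q (matroid_restrict N F))"

definition is_inverse_KL :: "('a indep_system \<Rightarrow> int poly) \<Rightarrow> bool" where
  "is_inverse_KL Q \<longleftrightarrow>
     (\<forall>N. is_matroid N \<and> loopless N \<longrightarrow>
        (matroid_rank N = 0 \<longrightarrow> Q N = 1) \<and>
        (0 < matroid_rank N \<longrightarrow> 2 * degree (Q N) < matroid_rank N) \<and>
        palindromic (matroid_rank N) (inverse_KL_sum Q N))"

text \<open>
  The assignment is only determined on loopless matroids, hence the description of its value at
  \<open>M\<close> rather than of the function itself.
\<close>

definition inverse_KL :: "'a indep_system \<Rightarrow> int poly" where
  "inverse_KL M = (THE q. \<exists>Q. is_inverse_KL Q \<and> q = Q M)"

definition binomial_normalization :: "int poly \<Rightarrow> int poly" where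
  "binomial_normalization q =
     (\<Sum>j\<le>degree q. monom (of_nat (degree q choose j) * coeff q j) j)"

definition real_rooted :: "int poly \<Rightarrow> bool" where
  "real_rooted p \<longleftrightarrow> (\<forall>z::complex. poly (map_poly of_int p) z = 0 \<longrightarrow> z \<in> \<real>)"


section \<open>Well-definedness\<close>

lemma
  assumes "is_matroid M"
  shows matroid_finite: "finite (ground M)"
    and indep_subset: "I \<in> indeps M \<Longrightarrow> I \<subseteq> ground M"
    and indep_empty: "{} \<in> indeps M"
    and indep_mono: "I \<in> indeps M \<Longrightarrow> J \<subseteq> I \<Longrightarrow> J \<in> indeps M"
    and indep_augment:
      "I \<in> indeps M \<Longrightarrow> J \<in> indeps M \<Longrightarrow> card I < card J \<Longrightarrow> \<exists>e\<in>J - I. insert e I \<in> indeps M"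
  using assms unfolding is_matroid_def by metis+

lemma finite_flats:
  assumes "is_matroid M"
  shows "finite (flats M)"
proof (rule finite_subset)
  show "flats M \<subseteq> Pow (ground M)" by (auto simp: flats_def)
  show "finite (Pow (ground M))" using matroid_finite[OF assms] by simp
qed

lemma ground_flat: "ground M \<in> flats M"
  by (auto simp: flats_def)

lemma flat_subset: "F \<in> flats M \<Longrightarrow> F \<subseteq> ground M"
  by (auto simp: flats_def)

lemma finite_indeps:
  assumes "is_matroid M"
  shows "finite (indeps M)"
proof (rule finite_subset)
  show "indeps M \<subseteq> Pow (ground M)" using indep_subset[OF assms] by blast
  show "finite (Pow (ground M))" using matroid_finite[OF assms] by simp
qed

lemma le_rk_iff:
  assumes "is_matroid M"
  shows "k \<le> rk M A \<longleftrightarrow> (\<exists>I\<in>indeps M. I \<subseteq> A \<and> k \<le> card I)"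
proof -
  have "{} \<in> indeps M" using assms by (rule indep_empty)
  then have "{I \<in> indeps M. I \<subseteq> A} \<noteq> {}" by auto
  then show ?thesis
    unfolding rk_def using finite_indeps[OF assms] by (subst Max_ge_iff) auto
qed

lemma rk_mono:
  assumes "is_matroid M" "A \<subseteq> B"
  shows "rk M A \<le> rk M B"
proof -
  obtain I where "I \<in> indeps M" "I \<subseteq> A" "rk M A \<le> card I"
    using le_rk_iff[OF assms(1), of "rk M A" A] by auto
  then show ?thesis
    using assms(2) le_rk_iff[OF assms(1), of "rk M A" B] by (meson subset_trans)
qed

lemma rk_restrict: "rk (matroid_restrict M F) F = rk M F"
  by (simp add: rk_def matroid_restrict_def conj_assoc)

lemma rank_restrict: "matroid_rank (matroid_restrict M F) = rk M F"
  using rk_restrict[of M F] by (simp add: matroid_rank_def matroid_restrict_def)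

lemma matroid_restrict:
  assumes "is_matroid M" "F \<subseteq> ground M"
  shows "is_matroid (matroid_restrict M F)"
  unfolding is_matroid_def
proof (intro conjI ballI allI impI)
  let ?N = "matroid_restrict M F"
  have iff: "I \<in> indeps ?N \<longleftrightarrow> I \<in> indeps M \<and> I \<subseteq> F" for I
    by (auto simp: matroid_restrict_def)
  have ground: "ground ?N = F" by (simp add: matroid_restrict_def)
  show "finite (ground ?N)" using finite_subset[OF assms(2)] matroid_finite[OF assms(1)] by (simp add: ground)
  show "{} \<in> indeps ?N" using indep_empty[OF assms(1)] by (simp add: iff)
  show "I \<subseteq> ground ?N" if "I \<in> indeps ?N" for I using that by (simp add: iff ground)
  show "J \<in> indeps ?N" if "I \<in> indeps ?N" "J \<subseteq> I" for I J
    using that indep_mono[OF assms(1), of I J] by (auto simp: iff)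
  show "\<exists>e\<in>J - I. insert e I \<in> indeps ?N"
    if "I \<in> indeps ?N" "J \<in> indeps ?N" "card I < card J" for I J
    using that indep_augment[OF assms(1), of I J] by (auto simp: iff)
qed

lemma loopless_restrict:
  assumes "loopless M" "F \<subseteq> ground M"
  shows "loopless (matroid_restrict M F)"
  using assms by (auto simp: loopless_def matroid_restrict_def)

lemma restrict_ground:
  assumes "is_matroid M"
  shows "matroid_restrict M (ground M) = M"
proof (rule indep_system.equality)
  show "indeps (matroid_restrict M (ground M)) = indeps M"
    using indep_subset[OF assms] by (auto simp: matroid_restrict_def)
qed (simp_all add: matroid_restrict_def)

lemma moebius_contract_ground: "matroid_moebius (matroid_contract M (ground M)) = 1"
  unfolding matroid_moebius_def by (subst moebius.simps) (simp add: matroid_contract_def)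

lemma loopless_rank_0:
  assumes "is_matroid M" "loopless M" "matroid_rank M = 0"
  shows "ground M = {}"
proof (rule ccontr)
  assume "ground M \<noteq> {}"
  then obtain e where e: "e \<in> ground M" by auto
  then have "{e} \<in> indeps M" using assms by (auto simp: loopless_def)
  then have "1 \<le> rk M (ground M)"
    using e by (subst le_rk_iff[OF assms(1)]) (auto intro!: bexI[of _ "{e}"])
  then show False using assms by (simp add: matroid_rank_def)
qed

lemma rank_two_matroid_indeps:
  assumes "partition_on E P" and "is_matroid N" "ground N = E" "loopless N" "matroid_rank N = 2"
    and flats: "{F \<in> flats N. rk N F = 1} = P"
  shows "indeps N = {I. I \<subseteq> E \<and> card I \<le> 2 \<and> (\<forall>B\<in>P. \<forall>a\<in>I \<inter> B. \<forall>b\<in>I \<inter> B. a = b)}"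
proof (intro set_eqI iffI CollectI conjI ballI)
  fix I assume I: "I \<in> indeps N"
  show "I \<subseteq> E" using I assms(2,3) indep_subset by blast
  then show "card I \<le> 2"
    using le_rk_iff[OF assms(2), of "card I" E] I assms(3,5) by (auto simp: matroid_rank_def)
  fix B a b assume B: "B \<in> P" "a \<in> I \<inter> B" "b \<in> I \<inter> B"
  show "a = b"
  proof (rule ccontr)
    assume "a \<noteq> b"
    moreover have "{a, b} \<in> indeps N"
      using indep_mono[OF assms(2) I, of "{a, b}"] B by blast
    ultimately have "2 \<le> rk N B"
      using B by (subst le_rk_iff[OF assms(2)]) (auto intro!: bexI[of _ "{a, b}"])
    then show False using B flats by auto
  qed
next
  fix I
  assume "I \<in> {I. I \<subseteq> E \<and> card I \<le> 2 \<and> (\<forall>B\<in>P. \<forall>a\<in>I \<inter> B. \<forall>b\<in>I \<inter> B. a = b)}"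
  then have I: "I \<subseteq> E" "card I \<le> 2" "\<And>B a b. B \<in> P \<Longrightarrow> a \<in> I \<inter> B \<Longrightarrow> b \<in> I \<inter> B \<Longrightarrow> a = b"
    by auto
  have "finite E" using assms(2,3) matroid_finite by blast
  then have fin: "finite I" using I(1) finite_subset by blast
  consider "card I = 0" | "card I = 1" | "card I = 2" using I(2) by linarith
  then show "I \<in> indeps N"
  proof cases
    case 1
    then show ?thesis using fin indep_empty[OF assms(2)] by simp
  next
    case 2
    then show ?thesis using I(1) assms(3,4) by (auto simp: card_1_singleton_iff loopless_def)
  next
    case 3
    then obtain a b where ab: "I = {a, b}" "a \<noteq> b" by (auto simp: card_2_iff)
    obtain A where A: "A \<in> P" "a \<in> A"
      using assms(1) I(1) ab by (auto simp: partition_on_def)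
    then have "b \<notin> A" using I(3)[of A a b] ab by auto
    moreover have "A \<in> flats N" "rk N A = 1" using A flats by auto
    ultimately have "2 \<le> rk N (insert b A)"
      using I(1) ab assms(3) by (force simp: flats_def)
    then obtain J where J: "J \<in> indeps N" "J \<subseteq> insert b A" "2 \<le> card J"
      using le_rk_iff[OF assms(2)] by blast
    moreover have "{a} \<in> indeps N" using I(1) ab assms(3,4) by (auto simp: loopless_def)
    moreover have "card {a} < card J" using J by simp
    ultimately obtain e where e: "e \<in> J - {a}" "insert e {a} \<in> indeps N"
      using indep_augment[OF assms(2)] by blast
    have "e \<notin> A"
    proof
      assume "e \<in> A"
      then have "2 \<le> rk N A"
        using A e by (subst le_rk_iff[OF assms(2)]) (auto intro!: bexI[of _ "{e, a}"])
      then show False using \<open>rk N A = 1\<close> by simp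
    qed
    then have "e = b" using e J by auto
    then show ?thesis using e ab by (simp add: insert_commute)
  qed
qed

lemma rank_two_matroid_exists:
  assumes "finite E" "partition_on E P" "2 \<le> card P"
  defines "N \<equiv> \<lparr>ground = E,
    indeps = {I. I \<subseteq> E \<and> card I \<le> 2 \<and> (\<forall>B\<in>P. \<forall>a\<in>I \<inter> B. \<forall>b\<in>I \<inter> B. a = b)}\<rparr>"
  shows "is_matroid N" "loopless N" "matroid_rank N = 2" "{F \<in> flats N. rk N F = 1} = P"
proof -
  have block: "\<exists>B\<in>P. a \<in> B" if "a \<in> E" for a
    using assms(2) that by (auto simp: partition_on_def)
  have block_unique: "A = B" if "A \<in> P" "B \<in> P" "a \<in> A" "a \<in> B" for A B a
    using assms(2) that by (auto simp: partition_on_def disjoint_def)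
  have block_ne: "B \<noteq> {}" "B \<subseteq> E" if "B \<in> P" for B
    using assms(2) that by (auto simp: partition_on_def)
  have pair: "{a, b} \<in> indeps N \<longleftrightarrow> a \<in> E \<and> b \<in> E \<and> (a = b \<or> (\<forall>B\<in>P. \<not> (a \<in> B \<and> b \<in> B)))"
    for a b by (auto simp: N_def card_insert_if)
  have single: "{a} \<in> indeps N \<longleftrightarrow> a \<in> E" for a
    using pair[of a a] by simp
  show mat: "is_matroid N"
    unfolding is_matroid_def
  proof (intro conjI ballI allI impI)
    show "finite (ground N)" "{} \<in> indeps N" using assms(1) by (auto simp: N_def)
    show "I \<subseteq> ground N" if "I \<in> indeps N" for I using that by (auto simp: N_def)
    show "J \<in> indeps N" if "I \<in> indeps N" "J \<subseteq> I" for I J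
    proof -
      have "card J \<le> card I"
        using that assms(1) by (intro card_mono) (auto simp: N_def intro: finite_subset)
      then show ?thesis using that by (auto simp: N_def) blast
    qed
    fix I J assume IJ: "I \<in> indeps N" "J \<in> indeps N" "card I < card J"
    have fin: "finite I" "finite J" using IJ assms(1) by (auto simp: N_def intro: finite_subset)
    have "card J \<le> 2" using IJ by (auto simp: N_def)
    then consider "card I = 0" | "card I = 1" "card J = 2" using IJ(3) by linarith
    then show "\<exists>e\<in>J - I. insert e I \<in> indeps N"
    proof cases
      case 1
      then have "I = {}" "J \<noteq> {}" using fin IJ by auto
      moreover have "J \<subseteq> E" using IJ by (auto simp: N_def)
      ultimately show ?thesis using single by auto
    next
      case 2
      then obtain a b c where abc: "I = {a}" "J = {b, c}" "b \<noteq> c"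
        by (auto simp: card_1_singleton_iff card_2_iff)
      then have "a \<in> E" using IJ(1) single by simp
      then obtain A where A: "A \<in> P" "a \<in> A" using block by blast
      have "b \<notin> A \<or> c \<notin> A" using IJ(2) A abc pair[of b c] by auto
      then obtain e where e: "e \<in> J" "e \<notin> A" using abc by auto
      then have "\<forall>B\<in>P. \<not> (e \<in> B \<and> a \<in> B)" using block_unique A by blast
      then have "{e, a} \<in> indeps N"
        using e IJ abc by (subst pair) (auto simp: N_def)
      then show ?thesis using e A abc by auto
    qed
  qed
  show "loopless N" using single by (auto simp: loopless_def N_def)
  have le2: "rk N A \<le> 2" for A
    using le_rk_iff[OF mat, of "rk N A" A] by (force simp: N_def)
  have rk1: "1 \<le> rk N A" if "a \<in> A" "a \<in> E" for A a
    using that single[of a] by (subst le_rk_iff[OF mat]) (auto intro!: bexI[of _ "{a}"])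
  have rk2: "2 \<le> rk N A \<longleftrightarrow>
      (\<exists>a\<in>A \<inter> E. \<exists>b\<in>A \<inter> E. \<forall>B\<in>P. \<not> (a \<in> B \<and> b \<in> B))" for A
  proof
    assume "2 \<le> rk N A"
    then obtain I where I: "I \<in> indeps N" "I \<subseteq> A" "2 \<le> card I"
      using le_rk_iff[OF mat] by blast
    then have "card I = 2" by (auto simp: N_def)
    then obtain a b where I_eq: "I = {a, b}" "a \<noteq> b" by (auto simp: card_2_iff)
    then have ab: "a \<in> A \<inter> E" "b \<in> A \<inter> E" "\<forall>B\<in>P. \<not> (a \<in> B \<and> b \<in> B)"
      using I(1,2) pair[of a b] by simp_all
    then show "\<exists>a\<in>A \<inter> E. \<exists>b\<in>A \<inter> E. \<forall>B\<in>P. \<not> (a \<in> B \<and> b \<in> B)"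
      by (metis (lifting))
  next
    assume "\<exists>a\<in>A \<inter> E. \<exists>b\<in>A \<inter> E. \<forall>B\<in>P. \<not> (a \<in> B \<and> b \<in> B)"
    then obtain a b where ab: "a \<in> A" "b \<in> A" "a \<in> E" "b \<in> E" "\<forall>B\<in>P. \<not> (a \<in> B \<and> b \<in> B)"
      by blast
    then have "a \<noteq> b" using block[of a] by metis
    moreover have "{a, b} \<in> indeps N" using ab by (simp add: pair)
    moreover have "{a, b} \<subseteq> A" "2 \<le> card {a, b}" using ab(1,2) \<open>a \<noteq> b\<close> by auto
    ultimately show "2 \<le> rk N A" using le_rk_iff[OF mat] by blast
  qed
  obtain A B where AB: "A \<in> P" "B \<in> P" "A \<noteq> B"
  proof -
    have "finite P" using assms(3) card.infinite by fastforce
    then show thesis using that assms(3) card_le_Suc0_iff_eq[of P] by fastforce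
  qed
  obtain a b where ab: "a \<in> A" "b \<in> B" using AB block_ne(1) by blast
  have "2 \<le> rk N E"
    unfolding rk2 using AB ab block_ne(2) block_unique by blast
  then show "matroid_rank N = 2"
    using le2[of E] by (simp add: matroid_rank_def N_def)
  show "{F \<in> flats N. rk N F = 1} = P"
  proof (intro equalityI subsetI)
    fix F assume "F \<in> {F \<in> flats N. rk N F = 1}"
    moreover have "ground N = E" by (simp add: N_def)
    ultimately have F: "F \<subseteq> E" "\<And>e. e \<in> E - F \<Longrightarrow> rk N F < rk N (insert e F)" "rk N F = 1"
      unfolding flats_def by auto
    then have "1 \<le> rk N F" by simp
    then obtain I where I: "I \<subseteq> F" "1 \<le> card I" using le_rk_iff[OF mat] by blast
    then have "I \<noteq> {}" by auto
    then obtain a where a: "a \<in> F" using I by blast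
    then obtain B where B: "B \<in> P" "a \<in> B" using block F(1) by blast
    have same: "c \<in> B" if "c \<in> F" for c
    proof -
      have "\<not> 2 \<le> rk N F" using F(3) by simp
      moreover have "a \<in> F \<inter> E" "c \<in> F \<inter> E" using that a F(1) by auto
      ultimately have "\<not> (\<forall>B\<in>P. \<not> (a \<in> B \<and> c \<in> B))" unfolding rk2[of F] by metis
      then obtain B' where "B' \<in> P" "a \<in> B'" "c \<in> B'" by metis
      then show ?thesis using block_unique B by blast
    qed
    have "c \<in> F" if c: "c \<in> B" for c
    proof (rule ccontr)
      assume "c \<notin> F"
      then have "2 \<le> rk N (insert c F)" using F(2)[of c] F(3) c block_ne(2)[OF B(1)] by auto
      then show False unfolding rk2 using same B(1) c by blast
    qed
    then have "F = B" using same by blast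
    then show "F \<in> P" using B by simp
  next
    fix F assume F: "F \<in> P"
    have "\<not> 2 \<le> rk N F" unfolding rk2 using F by blast
    moreover obtain a where a: "a \<in> F" using block_ne(1)[OF F] by blast
    ultimately have 1: "rk N F = 1" using rk1[OF a] block_ne(2)[OF F] by (simp add: subset_iff)
    have "rk N F < rk N (insert e F)" if "e \<in> E - F" for e
    proof -
      have "\<forall>B\<in>P. \<not> (a \<in> B \<and> e \<in> B)" using block_unique a F that by blast
      then have "2 \<le> rk N (insert e F)" unfolding rk2 using a that block_ne(2)[OF F] by blast
      then show ?thesis using 1 by simp
    qed
    moreover have "ground N = E" by (simp add: N_def)
    ultimately show "F \<in> {F \<in> flats N. rk N F = 1}"
      unfolding flats_def using 1 block_ne(2)[OF F] by blast
  qed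
qed

theorem rank_two_matroid_eq:
  assumes "finite E" "partition_on E P" "2 \<le> card P"
  shows "rank_two_matroid E P = \<lparr>ground = E,
    indeps = {I. I \<subseteq> E \<and> card I \<le> 2 \<and> (\<forall>B\<in>P. \<forall>a\<in>I \<inter> B. \<forall>b\<in>I \<inter> B. a = b)}\<rparr>"
  unfolding rank_two_matroid_def
proof (rule the_equality)
  show "N = \<lparr>ground = E,
    indeps = {I. I \<subseteq> E \<and> card I \<le> 2 \<and> (\<forall>B\<in>P. \<forall>a\<in>I \<inter> B. \<forall>b\<in>I \<inter> B. a = b)}\<rparr>"
    if "is_matroid N \<and> ground N = E \<and> loopless N \<and> matroid_rank N = 2 \<and>
        {F \<in> flats N. rk N F = 1} = P" for N
    using rank_two_matroid_indeps[OF assms(2), of N] that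
    by (intro indep_system.equality) simp_all
qed (intro conjI rank_two_matroid_exists[OF assms]; simp)

definition inverse_KL_rest :: "('a indep_system \<Rightarrow> int poly) \<Rightarrow> 'a indep_system \<Rightarrow> int poly" where
  "inverse_KL_rest Q N =
     (\<Sum>F\<in>flats N - {ground N}.
        monom ((-1) ^ (matroid_rank N - rk N F) * matroid_moebius (matroid_contract N F))
          (matroid_rank N - rk N F)
        * Q (matroid_restrict N F))"

lemma inverse_KL_sum_rest:
  assumes "is_matroid N"
  shows "inverse_KL_sum Q N = Q N + inverse_KL_rest Q N"
  unfolding inverse_KL_sum_def inverse_KL_rest_def
  by (subst sum.remove[OF finite_flats[OF assms] ground_flat])
     (simp add: moebius_contract_ground restrict_ground[OF assms] matroid_rank_def monom_0)

lemma inverse_KL_rest_cong: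
  assumes "\<And>F. F \<in> flats N \<Longrightarrow> F \<noteq> ground N \<Longrightarrow>
             Q (matroid_restrict N F) = Q' (matroid_restrict N F)"
  shows "inverse_KL_rest Q N = inverse_KL_rest Q' N"
  unfolding inverse_KL_rest_def by (rule sum.cong) (use assms in auto)

lemma is_inverse_KL_unique:
  assumes "is_inverse_KL Q" "is_inverse_KL Q'" "is_matroid N" "loopless N"
  shows "Q N = Q' N"
  using assms(3,4)
proof (induction "card (ground N)" arbitrary: N rule: less_induct)
  case less
  note N = less.prems
  let ?d = "matroid_rank N"
  have rest: "inverse_KL_rest Q N = inverse_KL_rest Q' N"
  proof (rule inverse_KL_rest_cong)
    fix F assume F: "F \<in> flats N" "F \<noteq> ground N"
    then have sub: "F \<subset> ground N" using flat_subset by blast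
    have "card (ground (matroid_restrict N F)) < card (ground N)"
      using N sub by (simp add: matroid_restrict_def matroid_finite psubset_card_mono)
    then show "Q (matroid_restrict N F) = Q' (matroid_restrict N F)"
      using less.hyps matroid_restrict loopless_restrict N sub by blast
  qed
  show ?case
  proof (cases "?d = 0")
    case True
    then show ?thesis using assms(1,2) N by (auto simp: is_inverse_KL_def)
  next
    case False
    have deg: "2 * degree (Q N) < ?d" "2 * degree (Q' N) < ?d"
      using assms(1,2) N False by (auto simp: is_inverse_KL_def)
    have pal: "palindromic ?d (Q N + inverse_KL_rest Q N)"
      "palindromic ?d (Q' N + inverse_KL_rest Q N)"
      using assms(1,2) N rest inverse_KL_sum_rest by (fastforce simp: is_inverse_KL_def)+
    show ?thesis
    proof (rule poly_eqI)
      fix i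
      show "coeff (Q N) i = coeff (Q' N) i"
      proof (cases "2 * i < ?d")
        case True
        then have "coeff (Q N) (?d - i) = 0" "coeff (Q' N) (?d - i) = 0"
          using deg by (auto intro!: coeff_eq_0)
        moreover have "i \<le> ?d" using True by simp
        ultimately show ?thesis
          using pal unfolding palindromic_def coeff_add by (metis add_right_cancel)
      next
        case False
        then show ?thesis using deg by (simp add: coeff_eq_0)
      qed
    qed
  qed
qed

function inverse_KL_rec :: "'a indep_system \<Rightarrow> int poly" where
  "inverse_KL_rec N =
     (if is_matroid N then
        if matroid_rank N = 0 then 1
        else let R = (\<Sum>F\<in>flats N - {ground N}.
                monom ((-1) ^ (matroid_rank N - rk N F) * matroid_moebius (matroid_contract N F))
                  (matroid_rank N - rk N F)
                * inverse_KL_rec (matroid_restrict N F))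
             in \<Sum>i | 2 * i < matroid_rank N. monom (coeff R (matroid_rank N - i) - coeff R i) i
      else 0)"
  by auto
termination
proof (relation "measure (card \<circ> ground)")
  fix N :: "'a indep_system" and F
  assume "is_matroid N" "F \<in> flats N - {ground N}"
  then have "finite (ground N)" "F \<subset> ground N"
    using flat_subset matroid_finite by blast+
  then show "(matroid_restrict N F, N) \<in> measure (card \<circ> ground)"
    by (auto simp: matroid_restrict_def intro: psubset_card_mono)
qed simp

declare inverse_KL_rec.simps [simp del]

lemma inverse_KL_rec_rank_0: "is_matroid N \<Longrightarrow> matroid_rank N = 0 \<Longrightarrow> inverse_KL_rec N = 1"
  by (subst inverse_KL_rec.simps) simp

lemma is_inverse_KL_rec: "is_inverse_KL inverse_KL_rec"
proof -
  let ?Q = inverse_KL_rec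
  have coeff: "coeff (?Q N) i =
      (if 2 * i < matroid_rank N then coeff (inverse_KL_rest ?Q N) (matroid_rank N - i)
         - coeff (inverse_KL_rest ?Q N) i else 0)"
    if "is_matroid N" "0 < matroid_rank N" for N :: "'a indep_system" and i
  proof -
    have fin: "finite {i. 2 * i < matroid_rank N}"
      by (rule finite_subset[of _ "{..matroid_rank N}"]) auto
    have "?Q N = (\<Sum>i | 2 * i < matroid_rank N. monom
        (coeff (inverse_KL_rest ?Q N) (matroid_rank N - i) - coeff (inverse_KL_rest ?Q N) i) i)"
      using that by (subst inverse_KL_rec.simps) (simp add: inverse_KL_rest_def Let_def)
    then show ?thesis
      using fin by (simp add: coeff_sum coeff_monom)
  qed
  have deg: "2 * degree (?Q N) < matroid_rank N" if "is_matroid N" "0 < matroid_rank N"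
    for N :: "'a indep_system"
  proof -
    have "degree (?Q N) \<le> (matroid_rank N - 1) div 2"
      by (rule degree_le) (use that in \<open>auto simp: coeff\<close>)
    then show ?thesis using that by linarith
  qed
  have deg': "degree (?Q N) \<le> matroid_rank N" if "is_matroid N" for N :: "'a indep_system"
    using deg[OF that] that by (cases "matroid_rank N = 0") (auto simp: inverse_KL_rec_rank_0)
  have "palindromic (matroid_rank N) (inverse_KL_sum ?Q N)"
    if N: "is_matroid N" "loopless N" for N :: "'a indep_system"
  proof (cases "matroid_rank N = 0")
    case True
    then have "flats N = {ground N}"
      using loopless_rank_0[OF N] ground_flat[of N] flat_subset[of _ N] by auto
    then have "inverse_KL_rest ?Q N = 0" by (simp add: inverse_KL_rest_def)
    then have "inverse_KL_sum ?Q N = 1"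
      using True N by (simp add: inverse_KL_sum_rest inverse_KL_rec_rank_0)
    then show ?thesis using True by (simp add: palindromic_def)
  next
    case False
    let ?d = "matroid_rank N" and ?R = "inverse_KL_rest ?Q N"
    have "degree ?R \<le> ?d"
      unfolding inverse_KL_rest_def
    proof (rule degree_sum_le)
      show "finite (flats N - {ground N})" using finite_flats[OF N(1)] by simp
      fix F assume F: "F \<in> flats N - {ground N}"
      have le: "rk N F \<le> ?d"
        using rk_mono[OF N(1) flat_subset] F by (auto simp: matroid_rank_def)
      have "degree (?Q (matroid_restrict N F)) \<le> rk N F"
        using deg'[OF matroid_restrict[OF N(1) flat_subset]] F by (auto simp: rank_restrict)
      then have "degree (monom c (?d - rk N F)) + degree (?Q (matroid_restrict N F)) \<le> ?d" for c
        using le degree_monom_le[of c "?d - rk N F"] by linarith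
      then show "degree (monom ((-1) ^ (?d - rk N F) * matroid_moebius (matroid_contract N F))
          (?d - rk N F) * ?Q (matroid_restrict N F)) \<le> ?d"
        using degree_mult_le order_trans by blast
    qed
    moreover have "degree (?Q N) \<le> ?d" using deg' N by blast
    ultimately have "degree (?Q N + ?R) \<le> ?d" by (rule degree_add_le[rotated])
    moreover have "coeff (?Q N + ?R) i = coeff (?Q N + ?R) (?d - i)" if "i \<le> ?d" for i
    proof -
      have "2 * i < ?d \<or> i = ?d - i \<or> (2 * (?d - i) < ?d \<and> \<not> 2 * i < ?d)"
        using that by arith
      then consider "2 * i < ?d" | "i = ?d - i" | "2 * (?d - i) < ?d" "\<not> 2 * i < ?d"
        by blast
      then show ?thesis
      proof cases
        case 2
        then show ?thesis by simp
      next
        case 1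
        then have "\<not> 2 * (?d - i) < ?d" by arith
        then show ?thesis using 1 that False N by (simp add: coeff)
      next
        case 3
        then show ?thesis using that False N by (simp add: coeff)
      qed
    qed
    ultimately show ?thesis
      unfolding inverse_KL_sum_rest[OF N(1)] palindromic_def by blast
  qed
  then show ?thesis
    using deg unfolding is_inverse_KL_def by (simp add: inverse_KL_rec_rank_0)
qed

theorem inverse_KL_eq:
  assumes "is_inverse_KL Q" "is_matroid M" "loopless M"
  shows "inverse_KL M = Q M"
  unfolding inverse_KL_def
  by (rule the_equality) (use assms is_inverse_KL_unique in blast)+

theorem is_inverse_KL_inverse_KL: "is_inverse_KL inverse_KL"
proof -
  have eq: "inverse_KL N = inverse_KL_rec N" if "is_matroid N" "loopless N"
    for N :: "'a indep_system"
    using inverse_KL_eq[OF is_inverse_KL_rec that] .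
  have "inverse_KL_sum inverse_KL N = inverse_KL_sum inverse_KL_rec N"
    if "is_matroid N" "loopless N" for N :: "'a indep_system"
    unfolding inverse_KL_sum_def
    by (rule sum.cong)
       (use that in \<open>simp_all add: eq flat_subset matroid_restrict loopless_restrict\<close>)
  then show ?thesis
    using is_inverse_KL_rec eq unfolding is_inverse_KL_def by simp
qed

end

theory Submission
  imports Defs "HOL-Computational_Algebra.Fundamental_Theorem_Algebra"
begin

text \<open>
  For a flat \<open>F\<close>, Rota's crosscut theorem gives
  $\mu(M/F) = \sum_A (-1)^{|A - F|}$ over the spanning sets $A \supseteq F$ of \<open>M\<close>; the
  same sum is 0 if \<open>F\<close> is not a flat. If \<open>M\<close> is dual to \<open>N\<close>, then the complements of spanning sets of \<open>M\<close> are the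
  independent sets of \<open>N\<close>, so the palindromic sum defining $Q_M$ runs over all subsets \<open>C\<close> of the
  ground set (with $F = E - C$) with weights counting independent subsets of \<open>C\<close> by parity. For \<open>N\<close>
  of rank 2, deleting a nonempty \<open>C\<close> from \<open>M\<close> leaves either a Boolean matroid, with $Q = 1$, or, if
  \<open>C\<close> lies in a block \<open>B\<close>, a matroid whose only circuit is $E - B$. This makes $Q_M$ explicit.
  Finally, $p = \mathcal{B}(Q_M)$ violates Laguerre's inequality $p\,p'' \le (p')^2$ at
  $x = -1$, so it is not real-rooted.
\<close>

section \<open>Rank, duality and contraction\<close>

text \<open>Complements are what make the sum tractable: the corank of \<open>E - C\<close> in
  \<open>M\<close> is \<open>card C - rk N C\<close>, and for nonempty \<open>C\<close> the rank
  \<open>rk N C\<close> is 1 or 2. So only two kinds of term occur. For \<open>C\<close> inside a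
  block \<open>B\<close> the deletion consists of the circuit \<open>E - B\<close> and the coloops
  \<open>B - C\<close>; each coloop multiplies the palindromic sum by 1 + x, so the polynomial of
  the deletion depends on \<open>B\<close> alone, and the whole sum depends only on the block sizes.
  No recursion is run to find a polynomial. If R is the contribution of the proper flats and d the
  rank, the degree bound and the symmetry force coefficient i to be R_(d-i) - R_i for 2i < d. All
  explicit coefficient lists arise this way and are then merely checked. Laguerre's inequality
  likewise replaces any location of roots by the evaluation of three integers.\<close>

lemma card_le_rk:
  assumes "is_matroid M" "I \<in> indeps M" "I \<subseteq> A"
  shows "card I \<le> rk M A"
  using assms le_rk_iff[OF assms(1)] by blast

lemma indep_finite: "is_matroid M \<Longrightarrow> I \<in> indeps M \<Longrightarrow> finite I"
  using indep_subset matroid_finite finite_subset by metis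

lemma indep_extend:
  assumes M: "is_matroid M" and "I \<in> indeps M" "I \<subseteq> A"
  obtains B where "B \<in> indeps M" "I \<subseteq> B" "B \<subseteq> A" "card B = rk M A"
proof -
  have "\<exists>B\<in>indeps M. I \<subseteq> B \<and> B \<subseteq> A \<and> card B = rk M A"
    using assms(2,3)
  proof (induction "rk M A - card I" arbitrary: I rule: less_induct)
    case less
    show ?case
    proof (cases "card I = rk M A")
      case True
      then show ?thesis using less.prems by blast
    next
      case False
      then have lt: "card I < rk M A" using card_le_rk[OF M less.prems] by simp
      obtain J where J: "J \<in> indeps M" "J \<subseteq> A" "rk M A \<le> card J"
        using le_rk_iff[OF M, of "rk M A" A] by auto
      then obtain e where e: "e \<in> J - I" "insert e I \<in> indeps M"
        using indep_augment[OF M less.prems(1) J(1)] lt by auto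
      then have "card (insert e I) = Suc (card I)"
        using indep_finite[OF M less.prems(1)] by simp
      then have "\<exists>B\<in>indeps M. insert e I \<subseteq> B \<and> B \<subseteq> A \<and> card B = rk M A"
        using less.hyps[of "insert e I"] lt e J(2) less.prems(2) by auto
      then show ?thesis by blast
    qed
  qed
  then show thesis using that by blast
qed

lemma basis_of_iff:
  assumes M: "is_matroid M"
  shows "basis_of M A B \<longleftrightarrow> B \<in> indeps M \<and> B \<subseteq> A \<and> card B = rk M A"
proof
  assume B: "basis_of M A B"
  then obtain B' where "B' \<in> indeps M" "B \<subseteq> B'" "B' \<subseteq> A" "card B' = rk M A"
    using indep_extend[OF M] unfolding basis_of_def by metis
  then show "B \<in> indeps M \<and> B \<subseteq> A \<and> card B = rk M A"
    using B unfolding basis_of_def by blast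
next
  assume B: "B \<in> indeps M \<and> B \<subseteq> A \<and> card B = rk M A"
  have "I = B" if "I \<in> indeps M" "B \<subseteq> I" "I \<subseteq> A" for I
    using B that card_le_rk[OF M that(1,3)] card_seteq[OF indep_finite[OF M that(1)], of B] by simp
  then show "basis_of M A B" using B unfolding basis_of_def by blast
qed

lemma basis_exists:
  assumes "is_matroid M"
  obtains B where "B \<in> indeps M" "B \<subseteq> A" "card B = rk M A"
  using indep_extend[OF assms indep_empty[OF assms], of A] by auto

lemma rk_le_card:
  assumes "is_matroid M" "finite A"
  shows "rk M A \<le> card A"
  using basis_exists[OF assms(1), of A] card_mono[OF assms(2)] by metis

lemma indep_iff_rk:
  assumes "is_matroid M" "A \<subseteq> ground M"
  shows "A \<in> indeps M \<longleftrightarrow> rk M A = card A"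
proof
  have fin: "finite A" using assms finite_subset matroid_finite by blast
  show "rk M A = card A" if "A \<in> indeps M"
    using card_le_rk[OF assms(1) that, of A] rk_le_card[OF assms(1) fin] by simp
  show "A \<in> indeps M" if "rk M A = card A"
    using basis_exists[OF assms(1), of A] that card_subset_eq[OF fin] by metis
qed

text \<open>Take a basis \<open>I\<close> of \<open>A\<close> inside a basis \<open>J\<close> of
  \<open>B\<close>. An element that augments \<open>J\<close> can only be \<open>e\<close>, and then
  \<open>insert e I\<close> is already independent in \<open>insert e A\<close>. Intersections of
  flats and the cancellation for non-flats both rest on this.\<close>

lemma rk_insert_eq_mono:
  assumes M: "is_matroid M" and "A \<subseteq> B" "rk M (insert e A) = rk M A"
  shows "rk M (insert e B) = rk M B"
proof (rule ccontr)
  assume "rk M (insert e B) \<noteq> rk M B"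
  then have lt: "rk M B < rk M (insert e B)"
    using rk_mono[OF M, of B "insert e B"] by fastforce
  obtain I where I: "I \<in> indeps M" "I \<subseteq> A" "card I = rk M A" using basis_exists[OF M] .
  then obtain J where J: "J \<in> indeps M" "I \<subseteq> J" "J \<subseteq> B" "card J = rk M B"
    using indep_extend[OF M, of I B] order_trans[OF I(2) assms(2)] by blast
  obtain K where K: "K \<in> indeps M" "K \<subseteq> insert e B" "card K = rk M (insert e B)"
    using basis_exists[OF M] .
  then obtain f where f: "f \<in> K - J" "insert f J \<in> indeps M"
    using indep_augment[OF M J(1) K(1)] J(4) lt by auto
  have "f \<notin> B"
  proof
    assume "f \<in> B"
    then have "card (insert f J) \<le> rk M B" using card_le_rk[OF M f(2)] J(3) by simp
    then show False using f(1) J(4) indep_finite[OF M J(1)] by simp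
  qed
  then have "f = e" "e \<notin> I" using f(1) K(2) I(2) assms(2) by auto
  then have "insert e I \<in> indeps M" using indep_mono[OF M f(2), of "insert e I"] J(2) by auto
  then have "card (insert e I) \<le> rk M (insert e A)" using card_le_rk[OF M] I(2) by blast
  then show False using \<open>e \<notin> I\<close> I indep_finite[OF M I(1)] assms(3) by simp
qed

section \<open>Dual matroids: independence and rank\<close>

lemma matroid_dual_ground [simp]: "ground (matroid_dual N) = ground N"
  by (simp add: matroid_dual_def)

lemma matroid_dual_indep_iff:
  assumes N: "is_matroid N"
  shows "I \<in> indeps (matroid_dual N) \<longleftrightarrow>
    I \<subseteq> ground N \<and> rk N (ground N - I) = matroid_rank N"
proof -
  have "(\<exists>B. basis_of N (ground N) B \<and> I \<inter> B = {}) \<longleftrightarrow> rk N (ground N - I) = matroid_rank N"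
  proof
    assume "\<exists>B. basis_of N (ground N) B \<and> I \<inter> B = {}"
    then obtain B where B: "B \<in> indeps N" "B \<subseteq> ground N - I" "card B = rk N (ground N)"
      unfolding basis_of_iff[OF N] by blast
    have "rk N (ground N - I) \<le> rk N (ground N)" by (rule rk_mono[OF N]) auto
    then show "rk N (ground N - I) = matroid_rank N"
      using card_le_rk[OF N B(1,2)] B(3) unfolding matroid_rank_def by simp
  next
    assume "rk N (ground N - I) = matroid_rank N"
    then obtain B where "B \<in> indeps N" "B \<subseteq> ground N - I" "card B = rk N (ground N)"
      using basis_exists[OF N, of "ground N - I"] unfolding matroid_rank_def by metis
    then show "\<exists>B. basis_of N (ground N) B \<and> I \<inter> B = {}"
      unfolding basis_of_iff[OF N] by blast
  qed
  then show ?thesis by (auto simp: matroid_dual_def)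
qed

lemma is_matroid_dual:
  assumes N: "is_matroid N"
  shows "is_matroid (matroid_dual N)"
  unfolding is_matroid_def
proof (intro conjI ballI allI impI)
  let ?E = "ground N"
  note iff = matroid_dual_indep_iff[OF N]
  have fin: "finite ?E" by (rule matroid_finite[OF N])
  show "finite (ground (matroid_dual N))" using fin by simp
  show "{} \<in> indeps (matroid_dual N)" by (simp add: iff matroid_rank_def)
  show "I \<subseteq> ground (matroid_dual N)" if "I \<in> indeps (matroid_dual N)" for I
    using that by (simp add: iff)
  show "J \<in> indeps (matroid_dual N)" if "I \<in> indeps (matroid_dual N)" "J \<subseteq> I" for I J
  proof -
    have "rk N (?E - I) \<le> rk N (?E - J)" "rk N (?E - J) \<le> rk N ?E"
      using that by (auto intro!: rk_mono[OF N])
    then show ?thesis using that by (auto simp: iff matroid_rank_def)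
  qed
  show "\<exists>e\<in>J - I. insert e I \<in> indeps (matroid_dual N)"
    if "I \<in> indeps (matroid_dual N)" "J \<in> indeps (matroid_dual N)" "card I < card J" for I J
  proof -
    have IJ: "I \<subseteq> ?E" "J \<subseteq> ?E" "rk N (?E - I) = rk N ?E" "rk N (?E - J) = rk N ?E"
      using that by (auto simp: iff matroid_rank_def)
    have finIJ: "finite I" "finite J" using IJ fin finite_subset by blast+
    obtain B where B: "B \<in> indeps N" "B \<subseteq> ?E - J" "card B = rk N ?E"
      using basis_exists[OF N, of "?E - J"] IJ(4) by metis
    have finB: "finite B" using indep_finite[OF N B(1)] .
    have "B - I \<in> indeps N" "B - I \<subseteq> ?E - I" using indep_mono[OF N B(1)] B(2) by auto
    then obtain B' where B': "B' \<in> indeps N" "B - I \<subseteq> B'" "B' \<subseteq> ?E - I" "card B' = rk N ?E"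
      using indep_extend[OF N, of "B - I" "?E - I"] IJ(3) by auto
    \<comment> \<open>\<open>B\<close> is a basis avoiding \<open>J\<close>, and \<open>B'\<close> a
      basis avoiding \<open>I\<close> that contains \<open>B - I\<close>. If \<open>B'\<close> also
      contained \<open>J - I\<close> it would be too big: \<open>B\<close> loses at most
      \<open>card (I - J)\<close> elements to \<open>I\<close>, and \<open>J - I\<close> has more.
      An element of \<open>J - I\<close> outside \<open>B'\<close> can join \<open>I\<close>, since
      \<open>B'\<close> avoids the result.\<close>
    have "\<not> J - I \<subseteq> B'"
    proof
      assume "J - I \<subseteq> B'"
      then have "card ((J - I) \<union> (B - I)) \<le> card B'"
        using B'(2) by (intro card_mono indep_finite[OF N B'(1)]) auto
      moreover have "card ((J - I) \<union> (B - I)) = card (J - I) + card (B - I)"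
        using B(2) finIJ finB by (intro card_Un_disjoint) auto
      moreover have "card (I - J) < card (J - I)"
        using that(3) finIJ by (metis card_less_sym_Diff)
      moreover have "card (B \<inter> I) \<le> card (I - J)"
        using B(2) finIJ by (intro card_mono) auto
      moreover have "card B = card (B \<inter> I) + card (B - I)"
        using finB by (metis card_Int_Diff)
      ultimately show False using B(3) B'(4) by simp
    qed
    then obtain e where e: "e \<in> J - I" "e \<notin> B'" by blast
    then have "card B' \<le> rk N (?E - insert e I)"
      using B'(3) by (intro card_le_rk[OF N B'(1)]) auto
    moreover have "rk N (?E - insert e I) \<le> rk N ?E" by (rule rk_mono[OF N]) auto
    ultimately have "insert e I \<in> indeps (matroid_dual N)"
      using e IJ B'(4) by (auto simp: iff matroid_rank_def)
    then show ?thesis using e(1) by blast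
  qed
qed

text \<open>Upper bound: a basis of \<open>N\<close> avoiding a largest dual-independent
  \<open>I\<close> in \<open>A\<close> has to share \<open>A\<close> with \<open>I\<close>. Lower
  bound: extend a basis of \<open>ground N - A\<close> to a basis \<open>B\<close> of
  \<open>N\<close>; then \<open>A - B\<close> is dual-independent. The additive form avoids
  truncated subtraction.\<close>

lemma rk_dual:
  assumes N: "is_matroid N" and A: "A \<subseteq> ground N"
  shows "rk (matroid_dual N) A + matroid_rank N = card A + rk N (ground N - A)"
proof (rule antisym)
  let ?E = "ground N" and ?M = "matroid_dual N"
  have fin: "finite A" using A matroid_finite[OF N] finite_subset by blast
  obtain I where I: "I \<in> indeps ?M" "I \<subseteq> A" "card I = rk ?M A"
    using basis_exists[OF is_matroid_dual[OF N]] .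
  then have "rk N (?E - I) = rk N ?E"
    using matroid_dual_indep_iff[OF N] by (simp add: matroid_rank_def)
  then obtain B where B: "B \<in> indeps N" "B \<subseteq> ?E - I" "card B = rk N ?E"
    using basis_exists[OF N, of "?E - I"] by metis
  have "card (B - A) \<le> rk N (?E - A)"
    using indep_mono[OF N B(1)] B(2) by (intro card_le_rk[OF N]) auto
  moreover have "card (B \<inter> A) + card I \<le> card A"
  proof -
    have "card ((B \<inter> A) \<union> I) = card (B \<inter> A) + card I"
      using B(2) I(2) fin finite_subset by (intro card_Un_disjoint) auto
    moreover have "card ((B \<inter> A) \<union> I) \<le> card A" using I(2) by (intro card_mono fin) auto
    ultimately show ?thesis by simp
  qed
  moreover have "card B = card (B \<inter> A) + card (B - A)"
    using indep_finite[OF N B(1)] by (metis card_Int_Diff)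
  ultimately show "rk ?M A + matroid_rank N \<le> card A + rk N (?E - A)"
    using I(3) B(3) by (simp add: matroid_rank_def)
next
  let ?E = "ground N" and ?M = "matroid_dual N"
  have fin: "finite A" using A matroid_finite[OF N] finite_subset by blast
  obtain B0 where B0: "B0 \<in> indeps N" "B0 \<subseteq> ?E - A" "card B0 = rk N (?E - A)"
    using basis_exists[OF N] .
  then obtain B where B: "B \<in> indeps N" "B0 \<subseteq> B" "B \<subseteq> ?E" "card B = rk N ?E"
    using indep_extend[OF N B0(1), of ?E] by blast
  have "A - B \<in> indeps ?M"
  proof -
    have "rk N (?E - (A - B)) \<le> rk N ?E" by (rule rk_mono[OF N]) auto
    moreover have "card B \<le> rk N (?E - (A - B))"
      using B(3) by (intro card_le_rk[OF N B(1)]) auto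
    ultimately show ?thesis using A B(4) by (auto simp: matroid_dual_indep_iff[OF N]
      matroid_rank_def)
  qed
  then have "card (A - B) \<le> rk ?M A" by (intro card_le_rk[OF is_matroid_dual[OF N]]) auto
  moreover have "card A = card (A \<inter> B) + card (A - B)" using fin by (metis card_Int_Diff)
  moreover have "card B = card (B \<inter> A) + card (B - A)"
    using indep_finite[OF N B(1)] by (metis card_Int_Diff)
  moreover have "card B0 \<le> card (B - A)"
    using B0(2) B(2) indep_finite[OF N B(1)] by (intro card_mono) auto
  ultimately show "card A + rk N (?E - A) \<le> rk ?M A + matroid_rank N"
    using B0(3) B(4) by (simp add: matroid_rank_def Int_commute)
qed

section \<open>Contractions\<close>

lemma is_matroid_contract:
  assumes M: "is_matroid M"
  shows "is_matroid (matroid_contract M F)"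
  unfolding is_matroid_def
proof (intro conjI ballI allI impI)
  let ?K = "matroid_contract M F"
  have iff: "I \<in> indeps ?K \<longleftrightarrow> I \<subseteq> ground M - F \<and>
      (\<exists>B. B \<in> indeps M \<and> B \<subseteq> F \<and> card B = rk M F \<and> I \<union> B \<in> indeps M)" for I
    by (auto simp: matroid_contract_def basis_of_iff[OF M])
  have ground: "ground ?K = ground M - F" by (simp add: matroid_contract_def)
  show "finite (ground ?K)" using matroid_finite[OF M] by (simp add: ground)
  show "{} \<in> indeps ?K" using basis_exists[OF M, of F] by (auto simp: iff)
  show "I \<subseteq> ground ?K" if "I \<in> indeps ?K" for I using that by (simp add: iff ground)
  show "J \<in> indeps ?K" if IJ: "I \<in> indeps ?K" "J \<subseteq> I" for I J
  proof -
    obtain B where B: "B \<in> indeps M" "B \<subseteq> F" "card B = rk M F" "I \<union> B \<in> indeps M"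
      using IJ(1) by (auto simp: iff)
    then have "J \<union> B \<in> indeps M" using indep_mono[OF M B(4), of "J \<union> B"] IJ(2) by blast
    then show ?thesis using IJ B by (auto simp: iff)
  qed
  show "\<exists>e\<in>J - I. insert e I \<in> indeps ?K"
    if IJ: "I \<in> indeps ?K" "J \<in> indeps ?K" "card I < card J" for I J
  proof -
    obtain B where B: "B \<in> indeps M" "B \<subseteq> F" "card B = rk M F" "I \<union> B \<in> indeps M"
      using IJ(1) by (auto simp: iff)
    obtain B' where B': "B' \<in> indeps M" "B' \<subseteq> F" "card B' = rk M F" "J \<union> B' \<in> indeps M"
      using IJ(2) by (auto simp: iff)
    have sub: "I \<subseteq> ground M - F" "J \<subseteq> ground M - F" using IJ by (auto simp: iff)
    have "card (I \<union> B) = card I + card B" "card (J \<union> B') = card J + card B'"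
      using sub B(2) B'(2) indep_finite[OF M B(4)] indep_finite[OF M B'(4)]
      by (auto intro!: card_Un_disjoint)
    then have "card (I \<union> B) < card (J \<union> B')" using IJ(3) B(3) B'(3) by simp
    then obtain e where e: "e \<in> J \<union> B' - (I \<union> B)" "insert e (I \<union> B) \<in> indeps M"
      using indep_augment[OF M B(4) B'(4)] by blast
    \<comment> \<open>The augmenting element might come from \<open>B'\<close> rather than
      \<open>J\<close>, but inside \<open>F\<close> it would enlarge \<open>B\<close>, which is
      already a basis of \<open>F\<close>.\<close>
    have "e \<notin> F"
    proof
      assume "e \<in> F"
      moreover have "insert e B \<in> indeps M" using indep_mono[OF M e(2), of "insert e B"] by auto
      ultimately have "card (insert e B) \<le> rk M F" using B(2) by (intro card_le_rk[OF M]) auto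
      then show False using e(1) B(3) indep_finite[OF M B(1)] by simp
    qed
    then have "e \<in> J - I" using e(1) B'(2) by blast
    moreover have "insert e I \<in> indeps ?K" using e(2) B sub \<open>e \<in> J - I\<close> by (auto simp: iff)
    ultimately show ?thesis by blast
  qed
qed

lemma rk_contract:
  assumes M: "is_matroid M" and A: "A \<subseteq> ground M - F"
  shows "rk (matroid_contract M F) A + rk M F = rk M (A \<union> F)"
proof (rule antisym)
  let ?K = "matroid_contract M F"
  obtain I where I: "I \<in> indeps ?K" "I \<subseteq> A" "card I = rk ?K A"
    using basis_exists[OF is_matroid_contract[OF M]] .
  then obtain B where B: "B \<subseteq> F" "card B = rk M F" "I \<union> B \<in> indeps M" "I \<inter> F = {}"
    by (auto simp: matroid_contract_def basis_of_iff[OF M])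
  have "card (I \<union> B) = card I + card B"
    using B indep_finite[OF M B(3)] by (intro card_Un_disjoint) auto
  moreover have "card (I \<union> B) \<le> rk M (A \<union> F)"
    using I(2) B(1) by (intro card_le_rk[OF M B(3)]) auto
  ultimately show "rk ?K A + rk M F \<le> rk M (A \<union> F)" using I(3) B(2) by simp
next
  let ?K = "matroid_contract M F"
  obtain B where B: "B \<in> indeps M" "B \<subseteq> F" "card B = rk M F" using basis_exists[OF M] .
  then obtain C where C: "C \<in> indeps M" "B \<subseteq> C" "C \<subseteq> A \<union> F" "card C = rk M (A \<union> F)"
    using indep_extend[OF M B(1), of "A \<union> F"] by blast
  have finC: "finite C" using indep_finite[OF M C(1)] .
  have "card (C \<inter> F) \<le> rk M F" by (rule card_le_rk[OF M]) (auto intro: indep_mono[OF M C(1)])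
  \<comment> \<open>\<open>B\<close> has the largest size possible inside \<open>F\<close>, so its
    extension \<open>C\<close> gains nothing there.\<close>
  then have CF: "C \<inter> F = B"
    using B C(2) finC card_seteq[of "C \<inter> F" B] by auto
  have "C - F \<union> C \<inter> F = C" by blast
  then have "C - F \<union> B \<in> indeps M" using C(1) CF by simp
  then have "C - F \<in> indeps ?K"
    using A C(3) B by (auto simp: matroid_contract_def basis_of_iff[OF M])
  then have "card (C - F) \<le> rk ?K A"
    using C(3) by (intro card_le_rk[OF is_matroid_contract[OF M]]) auto
  moreover have "card C = card (C \<inter> F) + card (C - F)" using finC by (metis card_Int_Diff)
  ultimately show "rk M (A \<union> F) \<le> rk ?K A + rk M F"
    using CF B(3) C(4) by simp
qed

section \<open>Moebius values as sums over spanning sets\<close>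

lemma sum_Pow_card:
  fixes f :: "nat \<Rightarrow> 'b::comm_semiring_1"
  assumes "finite A"
  shows "(\<Sum>X\<in>Pow A. f (card X)) = (\<Sum>k\<le>card A. of_nat (card A choose k) * f k)"
proof -
  have "(\<Sum>X\<in>Pow A. f (card X)) = (\<Sum>k\<le>card A. (\<Sum>X\<in>{X \<in> Pow A. card X = k}. f (card X)))"
    using assms by (intro sum.group[symmetric]) (auto intro: card_mono)
  also have "\<dots> = (\<Sum>k\<le>card A. of_nat (card A choose k) * f k)"
    using assms by (intro sum.cong) (simp_all add: n_subsets)
  finally show ?thesis .
qed

lemma sum_alternating_Pow:
  assumes "finite A"
  shows "(\<Sum>X\<in>Pow A. (-1) ^ card X) = (if A = {} then 1 else 0 :: int)"
proof -
  have "(\<Sum>X\<in>Pow A. (-1) ^ card X) = (\<Sum>k\<le>card A. of_nat (card A choose k) * (-1) ^ k :: int)"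
    by (rule sum_Pow_card[OF assms])
  also have "\<dots> = (if card A = 0 then 1 else 0)"
    using choose_alternating_sum[of "card A", where 'a = int] by (auto simp: mult.commute)
  finally show ?thesis using assms by simp
qed

text \<open>Sorting the subsets of \<open>G\<close> by their closure
  \<open>\<Inter>{H \<in> L. A \<subseteq> H}\<close> splits the alternating sum over
  \<open>Pow G\<close>, which is 0 for nonempty \<open>G\<close>, into one part for each member of
  \<open>L\<close> below \<open>G\<close>. These parts therefore obey the recursion that defines the
  Moebius function.\<close>

lemma moebius_crosscut:
  assumes fin: "finite E" and L: "L \<subseteq> Pow E" "E \<in> L" "{} \<in> L"
    and Inter: "\<And>S. S \<subseteq> L \<Longrightarrow> S \<noteq> {} \<Longrightarrow> \<Inter>S \<in> L"
    and "G \<in> L"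
  shows "moebius L {} G = (\<Sum>A | A \<subseteq> G \<and> \<Inter>{H \<in> L. A \<subseteq> H} = G. (-1) ^ card A)"
  using \<open>G \<in> L\<close>
proof (induction "card G" arbitrary: G rule: less_induct)
  case less
  let ?cl = "\<lambda>A. \<Inter>{H \<in> L. A \<subseteq> H}"
  have finG: "finite G" using less.prems L(1) fin finite_subset by blast
  have finL: "finite L" using L(1) fin by (meson finite_Pow_iff finite_subset)
  show ?case
  proof (cases "G = {}")
    case True
    have "{A. A \<subseteq> G \<and> ?cl A = G} = {{}}" using True L(3) by auto
    then show ?thesis using True by (simp add: moebius.simps)
  next
    case False
    define g where "g C = (\<Sum>A | A \<subseteq> C \<and> ?cl A = C. (-1) ^ card A :: int)" for C
    let ?K = "{C \<in> L. C \<subseteq> G}"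
    have cl: "?cl A \<in> ?K" if "A \<in> Pow G" for A
    proof -
      have "?cl A \<in> L" using L that less.prems by (intro Inter) auto
      then show ?thesis using that less.prems by auto
    qed
    have "(\<Sum>C\<in>?K. g C) = (\<Sum>C\<in>?K. (\<Sum>A\<in>{A \<in> Pow G. ?cl A = C}. (-1) ^ card A))"
    proof (rule sum.cong)
      fix C assume "C \<in> ?K"
      then have "{A. A \<subseteq> C \<and> ?cl A = C} = {A \<in> Pow G. ?cl A = C}" by auto
      then show "g C = (\<Sum>A\<in>{A \<in> Pow G. ?cl A = C}. (-1) ^ card A)" unfolding g_def by simp
    qed simp
    also have "\<dots> = (\<Sum>A\<in>Pow G. (-1) ^ card A)"
      using cl finG finL by (intro sum.group) auto
    also have "\<dots> = 0" using False finG by (simp add: sum_alternating_Pow)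
    finally have sum0: "(\<Sum>C\<in>?K. g C) = 0" .
    have "(\<Sum>C\<in>?K. g C) = g G + (\<Sum>C\<in>?K - {G}. g C)"
      using less.prems finL by (intro sum.remove) auto
    then have "g G = - (\<Sum>C\<in>?K - {G}. g C)" using sum0 by simp
    also have "?K - {G} = {C \<in> L. {} \<subseteq> C \<and> C \<subset> G}" by auto
    also have "(\<Sum>C | C \<in> L \<and> {} \<subseteq> C \<and> C \<subset> G. g C) = (\<Sum>C | C \<in> L \<and> {} \<subseteq> C \<and> C \<subset> G. moebius L {} C)"
    proof (rule sum.cong)
      fix C assume C: "C \<in> {C \<in> L. {} \<subseteq> C \<and> C \<subset> G}"
      then show "g C = moebius L {} C"
        using less.hyps[of C] psubset_card_mono[OF finG] unfolding g_def by auto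
    qed simp
    also have "- \<dots> = moebius L {} G"
      using False finG by (subst (2) moebius.simps) auto
    finally show ?thesis unfolding g_def by simp
  qed
qed

section \<open>Flats as closed sets, and spanning sets\<close>

lemma flats_Inter:
  assumes N: "is_matroid N" and "S \<subseteq> flats N" "S \<noteq> {}"
  shows "\<Inter>S \<in> flats N"
proof -
  have "rk N (\<Inter>S) < rk N (insert e (\<Inter>S))" if e: "e \<in> ground N - \<Inter>S" for e
  proof -
    obtain F where F: "F \<in> S" "e \<notin> F" using e by blast
    then have "F \<in> flats N" "e \<in> ground N - F" using assms(2) e by auto
    then have "rk N F < rk N (insert e F)" by (simp add: flats_def)
    then have "rk N (insert e F) \<noteq> rk N F" by simp
    moreover have "\<Inter>S \<subseteq> F" using \<open>F \<in> S\<close> by blast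
    ultimately have "rk N (insert e (\<Inter>S)) \<noteq> rk N (\<Inter>S)"
      using rk_insert_eq_mono[OF N] by metis
    moreover have "rk N (\<Inter>S) \<le> rk N (insert e (\<Inter>S))" by (rule rk_mono[OF N]) auto
    ultimately show ?thesis by simp
  qed
  moreover have "\<Inter>S \<subseteq> ground N" using assms(2,3) flat_subset by blast
  ultimately show ?thesis by (auto simp: flats_def)
qed

lemma flat_rank_eq_ground:
  assumes "is_matroid N" "G \<in> flats N" "rk N G = matroid_rank N"
  shows "G = ground N"
proof (rule ccontr)
  assume "G \<noteq> ground N"
  then obtain e where e: "e \<in> ground N - G" using flat_subset[OF assms(2)] by blast
  then have "rk N G < rk N (insert e G)" using assms(2) by (auto simp: flats_def)
  moreover have "rk N (insert e G) \<le> matroid_rank N"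
    unfolding matroid_rank_def using e flat_subset[OF assms(2)] by (intro rk_mono[OF assms(1)]) auto
  ultimately show False using assms(3) by simp
qed

lemma flat_hull_exists:
  assumes N: "is_matroid N" and "A \<subseteq> ground N"
  shows "\<exists>G\<in>flats N. A \<subseteq> G \<and> rk N G = rk N A"
  using assms(2)
proof (induction "card (ground N) - card A" arbitrary: A rule: less_induct)
  case less
  show ?case
  proof (cases "A \<in> flats N")
    case False
    then obtain e where e: "e \<in> ground N - A" "\<not> rk N A < rk N (insert e A)"
      using less.prems by (auto simp: flats_def)
    moreover have "rk N A \<le> rk N (insert e A)" by (rule rk_mono[OF N]) auto
    ultimately have eq: "rk N (insert e A) = rk N A" by simp
    have "card (insert e A) \<le> card (ground N)"
      using e less.prems by (intro card_mono matroid_finite[OF N]) auto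
    moreover have "card (insert e A) = Suc (card A)"
      using e finite_subset[OF less.prems matroid_finite[OF N]] by auto
    ultimately have "card (ground N) - card (insert e A) < card (ground N) - card A" by simp
    moreover have "insert e A \<subseteq> ground N" using e less.prems by blast
    ultimately have "\<exists>G\<in>flats N. insert e A \<subseteq> G \<and> rk N G = rk N (insert e A)"
      by (rule less.hyps)
    then show ?thesis using eq by auto
  qed auto
qed

text \<open>Identifies the index sets of \<open>moebius_crosscut\<close>, taken at the top flat, as
  the spanning sets.\<close>

lemma flat_hull_ground_iff:
  assumes N: "is_matroid N" and A: "A \<subseteq> ground N"
  shows "\<Inter>{H \<in> flats N. A \<subseteq> H} = ground N \<longleftrightarrow> rk N A = matroid_rank N"
proof
  assume hull: "\<Inter>{H \<in> flats N. A \<subseteq> H} = ground N"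
  obtain G where G: "G \<in> flats N" "A \<subseteq> G" "rk N G = rk N A" using flat_hull_exists[OF N A] by blast
  then have "G = ground N" using hull flat_subset by blast
  then show "rk N A = matroid_rank N" using G(3) by (simp add: matroid_rank_def)
next
  assume rk: "rk N A = matroid_rank N"
  have "H = ground N" if "H \<in> flats N" "A \<subseteq> H" for H
  proof (rule flat_rank_eq_ground[OF N that(1)])
    show "rk N H = matroid_rank N"
      using rk_mono[OF N that(2)] rk_mono[OF N flat_subset[OF that(1)]] rk
      by (simp add: matroid_rank_def)
  qed
  then show "\<Inter>{H \<in> flats N. A \<subseteq> H} = ground N" using ground_flat[of N] A by blast
qed

definition spanning_sum :: "'a indep_system \<Rightarrow> 'a set \<Rightarrow> int" where
  "spanning_sum M F =
     (\<Sum>A | F \<subseteq> A \<and> A \<subseteq> ground M \<and> rk M A = matroid_rank M. (-1) ^ card (A - F))"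

lemma matroid_moebius_eq_spanning_sum:
  assumes N: "is_matroid N" and "{} \<in> flats N"
  shows "matroid_moebius N = spanning_sum N {}"
proof -
  have "matroid_moebius N =
      (\<Sum>A | A \<subseteq> ground N \<and> \<Inter>{H \<in> flats N. A \<subseteq> H} = ground N. (-1) ^ card A)"
    unfolding matroid_moebius_def
    using flat_subset[of _ N] flats_Inter[OF N]
    by (intro moebius_crosscut[OF matroid_finite[OF N]]) (auto simp: ground_flat assms(2))
  also have "\<dots> = spanning_sum N {}"
    unfolding spanning_sum_def using flat_hull_ground_iff[OF N] by (intro sum.cong) auto
  finally show ?thesis .
qed

lemma moebius_contract:
  assumes M: "is_matroid M" and F: "F \<in> flats M"
  shows "matroid_moebius (matroid_contract M F) = spanning_sum M F"
proof -
  let ?K = "matroid_contract M F"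
  have K: "is_matroid ?K" by (rule is_matroid_contract[OF M])
  have ground: "ground ?K = ground M - F" by (simp add: matroid_contract_def)
  have FM: "F \<subseteq> ground M" by (rule flat_subset[OF F])
  have rkK: "rk ?K A + rk M F = rk M (A \<union> F)" if "A \<subseteq> ground ?K" for A
    using rk_contract[OF M] that ground by simp
  have rank: "matroid_rank ?K + rk M F = matroid_rank M"
    using rkK[of "ground ?K"] FM by (simp add: matroid_rank_def ground Un_absorb2)
  \<comment> \<open>\<open>matroid_moebius\<close> starts at the empty set, which is a flat of the
    contraction because \<open>F\<close> is a flat of \<open>M\<close>.\<close>
  have "{} \<in> flats ?K"
  proof -
    have "rk ?K {} < rk ?K {e}" if "e \<in> ground ?K" for e
    proof -
      have "rk M F < rk M (insert e F)" using F that by (simp add: flats_def ground)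
      then show ?thesis using rkK[of "{}"] rkK[of "{e}"] that by simp
    qed
    then show ?thesis by (simp add: flats_def)
  qed
  then have "matroid_moebius ?K = spanning_sum ?K {}"
    by (rule matroid_moebius_eq_spanning_sum[OF K])
  also have "\<dots> = spanning_sum M F"
    unfolding spanning_sum_def
  proof (rule sum.reindex_bij_witness[where i = "\<lambda>A. A - F" and j = "\<lambda>A. A \<union> F"])
    fix A assume A: "A \<in> {A. {} \<subseteq> A \<and> A \<subseteq> ground ?K \<and> rk ?K A = matroid_rank ?K}"
    then show "A \<union> F - F = A" "(-1::int) ^ card (A \<union> F - F) = (-1) ^ card (A - {})"
      by (auto simp: ground Un_Diff Diff_triv Int_commute intro!: arg_cong[where f = "\<lambda>A. (-1) ^
        card A"])
    show "A \<union> F \<in> {A. F \<subseteq> A \<and> A \<subseteq> ground M \<and> rk M A = matroid_rank M}"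
      using A rkK[of A] rank FM by (auto simp: ground)
  next
    fix A assume A: "A \<in> {A. F \<subseteq> A \<and> A \<subseteq> ground M \<and> rk M A = matroid_rank M}"
    then show *: "A - F \<union> F = A" by auto
    show "A - F \<in> {A. {} \<subseteq> A \<and> A \<subseteq> ground ?K \<and> rk ?K A = matroid_rank ?K}"
      using A rkK[of "A - F"] rank * by (simp add: ground Diff_mono)
  qed
  finally show ?thesis .
qed

text \<open>Some \<open>e\<close> outside \<open>F\<close> lies in the closure of \<open>F\<close>.
  Adding or removing \<open>e\<close> preserves the rank of every superset of \<open>F\<close> and
  flips the sign, so the terms cancel in pairs.\<close>

lemma spanning_sum_nonflat:
  assumes M: "is_matroid M" and F: "F \<subseteq> ground M" "F \<notin> flats M"
  shows "spanning_sum M F = 0"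
proof -
  obtain e where e: "e \<in> ground M - F" "\<not> rk M F < rk M (insert e F)"
    using F by (auto simp: flats_def)
  moreover have "rk M F \<le> rk M (insert e F)" by (rule rk_mono[OF M]) auto
  ultimately have "rk M (insert e F) = rk M F" by simp
  then have toggle: "rk M (insert e A) = rk M A" if "F \<subseteq> A" for A
    using rk_insert_eq_mono[OF M that] by blast
  define S where "S = {A. F \<subseteq> A \<and> A \<subseteq> ground M \<and> rk M A = matroid_rank M}"
  have finS: "finite S"
    unfolding S_def by (rule finite_subset[of _ "Pow (ground M)"]) (auto simp: matroid_finite[OF M])
  have "(\<Sum>A\<in>{A \<in> S. e \<in> A}. (-1) ^ card (A - F)) = (\<Sum>A\<in>{A \<in> S. e \<notin> A}. - ((-1::int) ^ card (A -
    F)))"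
  proof (rule sum.reindex_bij_witness[where i = "insert e" and j = "\<lambda>A. A - {e}"])
    fix A assume A: "A \<in> {A \<in> S. e \<in> A}"
    then have ins: "insert e (A - {e}) = A" by auto
    then show "insert e (A - {e}) = A" .
    have "F \<subseteq> A - {e}" using A e by (auto simp: S_def)
    then have "rk M (A - {e}) = rk M A" using toggle ins by metis
    then show "A - {e} \<in> {A \<in> S. e \<notin> A}" using A \<open>F \<subseteq> A - {e}\<close> by (auto simp: S_def)
    have "finite A" using A finite_subset matroid_finite[OF M] by (auto simp: S_def)
    moreover have "A - F = insert e (A - {e} - F)" using A e by auto
    ultimately have "card (A - F) = Suc (card (A - {e} - F))" by simp
    then show "- ((-1::int) ^ card (A - {e} - F)) = (-1) ^ card (A - F)" by simp
  next
    fix A assume A: "A \<in> {A \<in> S. e \<notin> A}"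
    then show "insert e A - {e} = A" by auto
    show "insert e A \<in> {A \<in> S. e \<in> A}" using A e toggle[of A] by (auto simp: S_def)
  qed
  moreover have "(\<Sum>A\<in>S. (-1::int) ^ card (A - F)) =
      (\<Sum>A\<in>{A \<in> S. e \<in> A}. (-1) ^ card (A - F)) + (\<Sum>A\<in>{A \<in> S. e \<notin> A}. (-1) ^ card (A - F))"
    using finS by (subst sum.union_disjoint[symmetric]) (auto intro: sum.cong)
  ultimately show ?thesis unfolding spanning_sum_def S_def by (simp add: sum_negf)
qed

text \<open>Summing over all subsets avoids any description of the lattice of flats: subsets that are not
  flats contribute 0.\<close>

lemma inverse_KL_rest_subsets:
  assumes N: "is_matroid N"
  shows "inverse_KL_rest Q N =
     (\<Sum>F\<in>Pow (ground N) - {ground N}.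
        monom ((-1) ^ (matroid_rank N - rk N F) * spanning_sum N F) (matroid_rank N - rk N F)
        * Q (matroid_restrict N F))"
  unfolding inverse_KL_rest_def
proof (rule sum.mono_neutral_cong_left)
  show "finite (Pow (ground N) - {ground N})" using matroid_finite[OF N] by simp
  show "flats N - {ground N} \<subseteq> Pow (ground N) - {ground N}" using flat_subset by blast
qed (auto simp: spanning_sum_nonflat[OF N] moebius_contract[OF N])

text \<open>Below the middle degree the reflected coefficient of \<open>q\<close> vanishes, so
  symmetry fixes \<open>coeff q i\<close> in terms of the rest. Every value of
  \<open>inverse_KL\<close> in positive rank below is obtained by checking a candidate against this
  criterion.\<close>

lemma inverse_KL_eqI:
  assumes N: "is_matroid N" "loopless N" "0 < matroid_rank N"
    and q: "2 * degree q < matroid_rank N"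
    and pal: "palindromic (matroid_rank N) (q + inverse_KL_rest inverse_KL N)"
  shows "inverse_KL N = q"
proof (rule poly_eqI)
  fix i
  let ?d = "matroid_rank N" and ?R = "inverse_KL_rest inverse_KL N"
  have deg: "2 * degree (inverse_KL N) < ?d"
    and pal': "palindromic ?d (inverse_KL N + ?R)"
    using is_inverse_KL_inverse_KL N inverse_KL_sum_rest[OF N(1)]
    unfolding is_inverse_KL_def by metis+
  show "coeff (inverse_KL N) i = coeff q i"
  proof (cases "2 * i < ?d")
    case True
    then have "coeff (inverse_KL N) (?d - i) = 0" "coeff q (?d - i) = 0"
      using deg q by (auto intro!: coeff_eq_0)
    moreover have "i \<le> ?d" using True by simp
    ultimately show ?thesis
      using pal pal' unfolding palindromic_def coeff_add by (metis add_right_cancel)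
  next
    case False
    then show ?thesis using deg q by (simp add: coeff_eq_0)
  qed
qed

section \<open>The palindromic sum of a dual, indexed by complements\<close>

lemma spanning_sum_dual:
  assumes N: "is_matroid N" and C: "C \<subseteq> ground N"
  shows "spanning_sum (matroid_dual N) (ground N - C) =
    (-1) ^ card C * (\<Sum>J | J \<in> indeps N \<and> J \<subseteq> C. (-1) ^ card J)"
proof -
  let ?E = "ground N" and ?M = "matroid_dual N"
  have fin: "finite ?E" by (rule matroid_finite[OF N])
  \<comment> \<open>By the rank formula for the dual, both sides say that
    \<open>rk N J = card J\<close>.\<close>
  have span: "rk ?M (?E - J) = matroid_rank ?M \<longleftrightarrow> J \<in> indeps N" if J: "J \<subseteq> ?E" for J
  proof -
    have "?E - (?E - J) = J" using J by blast
    then have "rk ?M (?E - J) + matroid_rank N = card (?E - J) + rk N J"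
      using rk_dual[OF N, of "?E - J"] by simp
    moreover have "matroid_rank ?M + matroid_rank N = card ?E + rk N {}"
      using rk_dual[OF N, of ?E] by (simp add: matroid_rank_def)
    moreover have "rk N {} = 0" using rk_le_card[OF N, of "{}"] by simp
    moreover have "card ?E = card J + card (?E - J)"
      using fin J by (metis card_Int_Diff Int_absorb1)
    ultimately show ?thesis using indep_iff_rk[OF N J] by linarith
  qed
  have "spanning_sum ?M (?E - C) = (\<Sum>J | J \<in> indeps N \<and> J \<subseteq> C. (-1) ^ card (C - J))"
    unfolding spanning_sum_def
  proof (rule sum.reindex_bij_witness[where i = "\<lambda>J. ?E - J" and j = "\<lambda>A. ?E - A"])
    fix A assume A: "A \<in> {A. ?E - C \<subseteq> A \<and> A \<subseteq> ground ?M \<and> rk ?M A = matroid_rank ?M}"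
    then show *: "?E - (?E - A) = A" by auto
    show "?E - A \<in> {J. J \<in> indeps N \<and> J \<subseteq> C}" using A span[of "?E - A"] * by auto
    have "C - (?E - A) = A - (?E - C)" using A C by auto
    then show "(-1::int) ^ card (C - (?E - A)) = (-1) ^ card (A - (?E - C))" by simp
  next
    fix J assume J: "J \<in> {J. J \<in> indeps N \<and> J \<subseteq> C}"
    then show "?E - (?E - J) = J" using C by auto
    show "?E - J \<in> {A. ?E - C \<subseteq> A \<and> A \<subseteq> ground ?M \<and> rk ?M A = matroid_rank ?M}"
      using J C span[of J] by auto
  qed
  also have "\<dots> = (\<Sum>J | J \<in> indeps N \<and> J \<subseteq> C. (-1) ^ card C * (-1) ^ card J)"
  proof (rule sum.cong)
    fix J assume "J \<in> {J. J \<in> indeps N \<and> J \<subseteq> C}"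
    then have "card C = card J + card (C - J)"
      using fin C by (metis (no_types, lifting) card_Int_Diff Int_absorb1 finite_subset
        mem_Collect_eq)
    then have "(-1::int) ^ card C * (-1) ^ card J = (-1) ^ (2 * card J) * (-1) ^ card (C - J)"
      by (simp add: power_add mult_2)
    then show "(-1) ^ card (C - J) = (-1::int) ^ card C * (-1) ^ card J" by simp
  qed simp
  finally show ?thesis by (simp add: sum_distrib_left)
qed

text \<open>The sign \<open>(-1) ^ (card C - rk N C)\<close> from the definition and
  \<open>(-1) ^ card C\<close> from \<open>spanning_sum_dual\<close> multiply to
  \<open>(-1) ^ rk N C\<close>. All weights and exponents are thereby expressed through
  \<open>N\<close>.\<close>

lemma inverse_KL_rest_dual:
  assumes N: "is_matroid N"
  shows "inverse_KL_rest Q (matroid_dual N) =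
    (\<Sum>C\<in>Pow (ground N) - {{}}.
       monom ((-1) ^ rk N C * (\<Sum>J | J \<in> indeps N \<and> J \<subseteq> C. (-1) ^ card J)) (card C - rk N C)
       * Q (matroid_restrict (matroid_dual N) (ground N - C)))"
  unfolding inverse_KL_rest_subsets[OF is_matroid_dual[OF N]]
proof (rule sum.reindex_bij_witness[where i = "\<lambda>C. ground N - C" and j = "\<lambda>F. ground N - F"])
  let ?E = "ground N" and ?M = "matroid_dual N"
  fix F assume "F \<in> Pow (ground ?M) - {ground ?M}"
  then have F: "F \<subseteq> ?E" "F \<noteq> ?E" by auto
  define C where "C = ?E - F"
  have FC: "F = ?E - C" "C \<subseteq> ?E" using F by (auto simp: C_def)
  show *: "?E - (?E - F) = F" using F by auto
  show "?E - F \<in> Pow ?E - {{}}" using F by auto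
  have "rk ?M F + matroid_rank N = card F + rk N C"
    using rk_dual[OF N F(1)] by (simp add: C_def)
  moreover have "matroid_rank ?M + matroid_rank N = card ?E + rk N {}"
    using rk_dual[OF N, of ?E] by (simp add: matroid_rank_def)
  moreover have "rk N {} = 0" using rk_le_card[OF N, of "{}"] by simp
  moreover have finC: "finite C" using FC(2) matroid_finite[OF N] finite_subset by blast
  moreover have "card ?E = card F + card C"
    using matroid_finite[OF N] F(1) unfolding C_def by (metis card_Int_Diff Int_absorb1)
  ultimately have rank: "matroid_rank ?M - rk ?M F = card C - rk N C" and le: "rk N C \<le> card C"
    using rk_le_card[OF N, of C] by linarith+
  obtain k where k: "card C = rk N C + k" using le le_iff_add by blast
  have sign: "(-1::int) ^ (card C - rk N C) * (-1) ^ card C = (-1) ^ rk N C"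
    unfolding k by (simp add: minus_one_power_iff)
  have "(-1) ^ (matroid_rank ?M - rk ?M F) * spanning_sum ?M F
      = (-1) ^ rk N C * (\<Sum>J | J \<in> indeps N \<and> J \<subseteq> C. (-1) ^ card J)"
    unfolding rank unfolding FC(1) spanning_sum_dual[OF N FC(2)] mult.assoc[symmetric] sign ..
  then show "monom ((-1) ^ rk N (?E - F) * (\<Sum>J | J \<in> indeps N \<and> J \<subseteq> ?E - F. (-1) ^ card J))
      (card (?E - F) - rk N (?E - F)) * Q (matroid_restrict ?M (?E - (?E - F))) =
    monom ((-1) ^ (matroid_rank ?M - rk ?M F) * spanning_sum ?M F) (matroid_rank ?M - rk ?M F)
      * Q (matroid_restrict ?M F)"
    unfolding * unfolding C_def[symmetric] rank by simp
next
  fix C assume "C \<in> Pow (ground N) - {{}}"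
  then show "ground N - (ground N - C) = C"
    "ground N - C \<in> Pow (ground (matroid_dual N)) - {ground (matroid_dual N)}" by auto
qed

section \<open>Boolean matroids and matroids with a single circuit\<close>

lemma linear_power_eq_sum: "[:1, 1:] ^ n = (\<Sum>k\<le>n. of_nat (n choose k) * monom (1::int) k)"
proof (rule poly_eqI)
  fix i
  have *: "coeff (of_nat a * monom (1::int) k) i = (if i = k then int a else 0)" for a k
    by (simp add: of_nat_poly)
  show "coeff ([:1, 1:] ^ n) i = coeff (\<Sum>k\<le>n. of_nat (n choose k) * monom (1::int) k) i"
  proof (cases "i \<le> n")
    case False
    then have "coeff ([:1, 1::int:] ^ n) i = 0" by (intro coeff_eq_0) (simp add:
      degree_linear_power)
    then show ?thesis unfolding coeff_sum * using False by simp
  qed (unfold coeff_sum *, simp add: coeff_linear_poly_power)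
qed

lemma sum_monom_card_Pow:
  assumes "finite A"
  shows "(\<Sum>X\<in>Pow A. monom (1::int) (card X)) = [:1, 1:] ^ card A"
  using sum_Pow_card[OF assms, of "monom (1::int)"] by (simp add: linear_power_eq_sum)

lemma sum_monom_card_superset:
  assumes "finite A" "J \<subseteq> A"
  shows "(\<Sum>X | J \<subseteq> X \<and> X \<subseteq> A. monom (1::int) (card X)) = monom 1 (card J) * [:1, 1:] ^ (card A -
    card J)"
proof -
  have "(\<Sum>X | J \<subseteq> X \<and> X \<subseteq> A. monom (1::int) (card X)) =
      (\<Sum>Y\<in>Pow (A - J). monom 1 (card J) * monom (1::int) (card Y))"
  proof (rule sum.reindex_bij_witness[where i = "\<lambda>Y. J \<union> Y" and j = "\<lambda>X. X - J"])
    fix X assume X: "X \<in> {X. J \<subseteq> X \<and> X \<subseteq> A}"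
    then have "finite X" using assms(1) finite_subset by blast
    then have "card X = card J + card (X - J)" using X by (metis (no_types, lifting) card_Int_Diff
      Int_absorb1 mem_Collect_eq)
    then show "monom 1 (card J) * monom (1::int) (card (X - J)) = monom 1 (card X)"
      by (simp add: mult_monom)
  qed (use assms(2) in auto)
  also have "\<dots> = monom 1 (card J) * [:1, 1:] ^ card (A - J)"
    using assms by (simp add: sum_monom_card_Pow flip: sum_distrib_left)
  finally show ?thesis using assms by (simp add: card_Diff_subset finite_subset)
qed

text \<open>A coloop raises the rank by one and multiplies the palindromic sum by 1 + x. That
  symmetry survives this is the reason why coloops leave the inverse polynomial unchanged.\<close>

lemma palindromic_linear_mult:
  assumes "palindromic d p"
  shows "palindromic (Suc d) ([:1, 1:] * p)"
proof -
  have coeff: "coeff ([:1, 1:] * p) i = coeff p i + (case i of 0 \<Rightarrow> 0 | Suc j \<Rightarrow> coeff p j)" for i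
    by (cases i) auto
  have deg: "degree p \<le> d" and sym: "\<And>i. i \<le> d \<Longrightarrow> coeff p i = coeff p (d - i)"
    using assms unfolding palindromic_def by blast+
  have top: "coeff p (Suc d) = 0" using deg by (intro coeff_eq_0) simp
  have "coeff ([:1, 1:] * p) i = coeff ([:1, 1:] * p) (Suc d - i)" if "i \<le> Suc d" for i
  proof (cases "i = 0 \<or> i = Suc d")
    case False
    then obtain j where "i = Suc j" "j < d" using \<open>i \<le> Suc d\<close> by (cases i) auto
    then obtain k where k: "d = Suc (j + k)" using less_iff_Suc_add by blast
    then have "coeff p (Suc j) = coeff p k" "coeff p j = coeff p (Suc k)"
      using sym[of "Suc j"] sym[of j] by simp_all
    then show ?thesis unfolding coeff using \<open>i = Suc j\<close> k by simp
  qed (use top sym[of 0] in \<open>auto simp: coeff\<close>)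
  moreover have "degree ([:1, 1:] * p) \<le> Suc d"
    using degree_mult_le[of "[:1, 1:]" p] deg by simp
  ultimately show ?thesis unfolding palindromic_def by blast
qed

lemma palindromic_linear_power_mult:
  "palindromic d p \<Longrightarrow> palindromic (n + d) ([:1, 1:] ^ n * p)"
  by (induction n) (simp_all only: power_0 mult_1 add_0 power_Suc mult.assoc add_Suc
    palindromic_linear_mult)

text \<open>Only the ground set is spanning, so the two signs of each term cancel and a flat
  contributes x to the power of its corank. The total is \<open>(1 + x) ^ n\<close>, which is
  symmetric already with the constant 1.\<close>

lemma inverse_KL_Boolean:
  assumes "finite (ground N)" "indeps N = Pow (ground N)"
  shows "inverse_KL N = 1"
  using assms
proof (induction "card (ground N)" arbitrary: N rule: less_induct)
  case less
  let ?E = "ground N"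
  have N: "is_matroid N"
    unfolding is_matroid_def less.prems(2)
  proof (intro conjI ballI allI impI)
    fix I J assume IJ: "I \<in> Pow ?E" "J \<in> Pow ?E" "card I < card J"
    then have "\<not> J \<subseteq> I" using less.prems(1) by (meson PowD card_mono finite_subset not_less)
    then show "\<exists>e\<in>J - I. insert e I \<in> Pow ?E" using IJ by blast
  qed (use less.prems(1) in auto)
  have loopless: "loopless N" by (auto simp: loopless_def less.prems(2))
  have rk: "rk N A = card A" if "A \<subseteq> ?E" for A
    using indep_iff_rk[OF N that] that less.prems(2) by simp
  have rank: "matroid_rank N = card ?E" by (simp add: matroid_rank_def rk)
  show ?case
  proof (cases "card ?E = 0")
    case True
    then show ?thesis
      using is_inverse_KL_inverse_KL N loopless rank unfolding is_inverse_KL_def by metis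
  next
    case False
    have summand: "monom ((-1) ^ (matroid_rank N - rk N F) * spanning_sum N F) (matroid_rank N -
      rk N F)
        * inverse_KL (matroid_restrict N F) = monom 1 (card (?E - F))"
      if F: "F \<in> Pow ?E - {?E}" for F
    proof -
      have "{A. F \<subseteq> A \<and> A \<subseteq> ?E \<and> rk N A = card ?E} = {?E}"
      proof (intro equalityI subsetI)
        fix A assume "A \<in> {A. F \<subseteq> A \<and> A \<subseteq> ?E \<and> rk N A = card ?E}"
        then show "A \<in> {?E}" using rk[of A] card_subset_eq[OF less.prems(1)] by simp
      qed (use F rk[of ?E] in auto)
      then have "spanning_sum N F = (-1) ^ card (?E - F)"
        by (simp add: spanning_sum_def rank)
      moreover have "matroid_rank N - rk N F = card (?E - F)"
        using F rk[of F] less.prems(1) card_Diff_subset[of F ?E] finite_subset[of F ?E]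
        by (simp add: rank)
      moreover have "inverse_KL (matroid_restrict N F) = 1"
        using F less.prems finite_subset
        by (intro less.hyps) (auto simp: matroid_restrict_def intro!: psubset_card_mono)
      ultimately show ?thesis by (simp flip: power_add mult_2)
    qed
    have "1 + inverse_KL_rest inverse_KL N = 1 + (\<Sum>F\<in>Pow ?E - {?E}. monom 1 (card (?E - F)))"
      unfolding inverse_KL_rest_subsets[OF N] using summand by (intro arg_cong2[where f = "(+)"]
        sum.cong) auto
    also have "\<dots> = (\<Sum>F\<in>Pow ?E. monom 1 (card (?E - F)))"
      using less.prems(1) by (subst sum.remove[where x = ?E]) auto
    also have "\<dots> = (\<Sum>X\<in>Pow ?E. monom 1 (card X))"
      by (rule sum.reindex_bij_witness[where i = "\<lambda>X. ?E - X" and j = "\<lambda>X. ?E - X"]) auto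
    also have "\<dots> = [:1, 1:] ^ card ?E * 1"
      using sum_monom_card_Pow[OF less.prems(1)] by simp
    finally have sum: "1 + inverse_KL_rest inverse_KL N = [:1, 1:] ^ card ?E * 1" .
    have "palindromic (card ?E + 0) ([:1, 1:] ^ card ?E * 1)"
      by (rule palindromic_linear_power_mult) (simp add: palindromic_def)
    then show ?thesis
      using False by (intro inverse_KL_eqI[OF N loopless]) (simp_all add: rank sum)
  qed
qed

text \<open>The contribution of the proper flats to the palindromic sum of a circuit with \<open>m\<close>
  elements. Truncated subtraction makes the summand for \<open>k = 0\<close> vanish.\<close>

definition circuit_poly :: "nat \<Rightarrow> int poly" where
  "circuit_poly m = (\<Sum>k\<le>m. of_nat (m choose k) * monom (int (k - 1)) (k - 1))"

text \<open>\<open>N\<close> is a circuit \<open>D\<close> together with coloops. A restriction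
  containing \<open>D\<close> is of the same kind, any other is Boolean, and the sum factors as
  \<open>q + circuit_poly (card D)\<close> times a power of 1 + x. Constraining \<open>q\<close>
  only by the symmetry for the bare circuit lets one induction serve every number of
  coloops.\<close>

lemma inverse_KL_single_circuit:
  assumes "finite (ground N)" "indeps N = {I. I \<subseteq> ground N \<and> \<not> D \<subseteq> I}"
    and "D \<subseteq> ground N" "2 \<le> card D"
    and q: "2 * degree q < card D - 1" "palindromic (card D - 1) (q + circuit_poly (card D))"
  shows "inverse_KL N = q"
  using assms(1-3)
proof (induction "card (ground N)" arbitrary: N rule: less_induct)
  case less
  let ?E = "ground N"
  note D = less.prems(3) and fin = less.prems(1)
  have indep: "I \<in> indeps N \<longleftrightarrow> I \<subseteq> ?E \<and> \<not> D \<subseteq> I" for I using less.prems(2) by auto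
  have finD: "finite D" using fin D finite_subset by blast
  have finF: "finite F" if "F \<subseteq> ?E" for F using fin that finite_subset by blast
  have N: "is_matroid N"
    unfolding is_matroid_def
  proof (intro conjI ballI allI impI)
    show "{} \<in> indeps N" using assms(4) by (auto simp: indep)
    fix I J assume IJ: "I \<in> indeps N" "J \<in> indeps N" "card I < card J"
    show "\<exists>e\<in>J - I. insert e I \<in> indeps N"
    proof (rule ccontr)
      assume neg: "\<not> (\<exists>e\<in>J - I. insert e I \<in> indeps N)"
      have sub: "D \<subseteq> insert e I" "e \<in> D" if "e \<in> J - I" for e
        using neg that IJ(1,2) by (auto simp: indep)
      have finIJ: "finite I" "finite J" using IJ finF by (auto simp: indep)
      then have "\<not> J \<subseteq> I" using IJ(3) card_mono leD by blast
      then obtain e where e: "e \<in> J - I" by blast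
      then have "J - I = {e}" using sub by blast
      moreover have "card (I - J) < card (J - I)"
        using IJ(3) finIJ by (metis card_less_sym_Diff)
      ultimately have "I \<subseteq> J" using finIJ by simp
      then show False using sub(1)[OF e] e IJ(2) by (auto simp: indep)
    qed
  qed (use fin in \<open>auto simp: indep\<close>)
  have loopless: "loopless N"
  proof -
    have "\<not> D \<subseteq> {e}" for e using assms(4) card_mono[of "{e}" D] by auto
    then show ?thesis by (auto simp: loopless_def indep)
  qed
  have rk_indep: "rk N A = card A" if "A \<subseteq> ?E" "\<not> D \<subseteq> A" for A
    using indep_iff_rk[OF N that(1)] that by (simp add: indep)
  have rk_dep: "Suc (rk N A) = card A" if A: "A \<subseteq> ?E" "D \<subseteq> A" for A
  proof -
    obtain d where d: "d \<in> D" using assms(4) by fastforce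
    then have "A - {d} \<in> indeps N" using A by (auto simp: indep)
    then have "card (A - {d}) \<le> rk N A" by (intro card_le_rk[OF N]) auto
    moreover have "rk N A \<noteq> card A" using indep_iff_rk[OF N A(1)] A by (simp add: indep)
    moreover have "rk N A \<le> card A" by (rule rk_le_card[OF N finF[OF A(1)]])
    moreover have "card A = Suc (card (A - {d}))"
      using d A finF by (metis card.remove subset_iff)
    ultimately show ?thesis by simp
  qed
  have rank: "Suc (matroid_rank N) = card ?E" unfolding matroid_rank_def using rk_dep D by simp
  have span: "spanning_sum N F = (-1) ^ card (?E - F) * (1 - int (card (D - F)))"
    if F: "F \<subseteq> ?E" for F
  proof -
    \<comment> \<open>The rank is one below \<open>card ?E\<close>, so a spanning set misses at most
      one element, and never a coloop. Sets missing an element carry the opposite sign, whence the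
      factor \<open>1 - card (D - F)\<close>.\<close>
    have "{A. F \<subseteq> A \<and> A \<subseteq> ?E \<and> rk N A = matroid_rank N} = insert ?E ((\<lambda>e. ?E - {e}) ` (D - F))"
    proof (intro set_eqI iffI)
      fix A assume A: "A \<in> {A. F \<subseteq> A \<and> A \<subseteq> ?E \<and> rk N A = matroid_rank N}"
      show "A \<in> insert ?E ((\<lambda>e. ?E - {e}) ` (D - F))"
      proof (cases "D \<subseteq> A")
        case True
        then have "card A = card ?E" using A rk_dep[of A] rank by simp
        then show ?thesis using A card_subset_eq[OF fin] by blast
      next
        case False
        then have card: "card A = card ?E - 1" using A rk_indep[of A] rank by simp
        obtain e where e: "e \<in> D" "e \<notin> A" using False by blast
        then have "card (?E - {e}) = card ?E - 1" using D fin by auto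
        then have "A = ?E - {e}" using A e card fin by (intro card_subset_eq) auto
        then show ?thesis using e A by blast
      qed
    next
      fix A assume "A \<in> insert ?E ((\<lambda>e. ?E - {e}) ` (D - F))"
      then consider "A = ?E" | e where "e \<in> D - F" "A = ?E - {e}" by blast
      then show "A \<in> {A. F \<subseteq> A \<and> A \<subseteq> ?E \<and> rk N A = matroid_rank N}"
      proof cases
        case 2
        then have "rk N A = card A" by (intro rk_indep) auto
        moreover have "card A = card ?E - 1" using 2 D fin by auto
        ultimately show ?thesis using 2 F rank by auto
      qed (use F in \<open>simp add: matroid_rank_def\<close>)
    qed
    moreover have "?E \<notin> (\<lambda>e. ?E - {e}) ` (D - F)" using D by auto
    moreover have "inj_on (\<lambda>e. ?E - {e}) (D - F)" using D by (auto simp: inj_on_def)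
    ultimately have "spanning_sum N F = (-1) ^ card (?E - F) + (\<Sum>e\<in>D - F. (-1) ^ card (?E - {e} -
      F))"
      unfolding spanning_sum_def using finD by (simp add: sum.reindex)
    also have "(\<Sum>e\<in>D - F. (-1::int) ^ card (?E - {e} - F)) = (\<Sum>e\<in>D - F. - ((-1) ^ card (?E - F)))"
    proof (rule sum.cong)
      fix e assume e: "e \<in> D - F"
      then have "?E - F = insert e (?E - {e} - F)" using D by auto
      moreover have "finite (?E - {e} - F)" using fin by simp
      ultimately have "card (?E - F) = Suc (card (?E - {e} - F))" by (metis DiffE
        card_insert_disjoint insertI1)
      then show "(-1::int) ^ card (?E - {e} - F) = - ((-1) ^ card (?E - F))" by simp
    qed simp
    finally show ?thesis by (simp add: algebra_simps)
  qed
  have summand: "monom ((-1) ^ (matroid_rank N - rk N F) * spanning_sum N F) (matroid_rank N - rk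
    N F)
      * inverse_KL (matroid_restrict N F) =
      (if D \<subseteq> F then monom 1 (card (?E - F)) * q
       else monom (int (card (D - F) - 1)) (card (?E - F) - 1))"
    if F: "F \<in> Pow ?E - {?E}" for F
  proof (cases "D \<subseteq> F")
    case True
    have "matroid_rank N - rk N F = card (?E - F)"
      using rank rk_dep[of F] F True finF[of F] by (simp add: card_Diff_subset)
    moreover have "spanning_sum N F = (-1) ^ card (?E - F)"
      using span[of F] F True by (simp add: Diff_eq_empty_iff[THEN iffD2])
    moreover have "inverse_KL (matroid_restrict N F) = q"
      using F True finF[of F] fin less.prems(2)
      by (intro less.hyps) (auto simp: matroid_restrict_def intro!: psubset_card_mono)
    ultimately show ?thesis using True by (simp flip: power_add mult_2)
  next
    case False
    then have "D - F \<subseteq> ?E - F" "D - F \<noteq> {}" using D by auto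
    then have pos: "0 < card (?E - F)" "0 < card (D - F)"
      using fin finD by (auto simp: card_gt_0_iff)
    then obtain k where k: "card (?E - F) = Suc k" using gr0_implies_Suc by blast
    have "matroid_rank N - rk N F = k"
      using rank rk_indep[of F] F False finF[of F] k by (simp add: card_Diff_subset)
    moreover have "spanning_sum N F = (-1) ^ k * int (card (D - F) - 1)"
      using span[of F] F pos(2) by (simp add: k of_nat_diff algebra_simps)
    moreover have "inverse_KL (matroid_restrict N F) = 1"
      using F False finF[of F] less.prems(2)
      by (intro inverse_KL_Boolean) (auto simp: matroid_restrict_def)
    ultimately show ?thesis
      using False k by (simp flip: power_add mult_2 mult.assoc)
  qed
  \<comment> \<open>\<open>U X\<close> is the term of the set \<open>?E - X\<close>, with
    \<open>X = {}\<close> accounting for \<open>q\<close> itself; \<open>V\<close> is its factor on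
    the circuit. Each element of \<open>X - D\<close> contributes only a factor x.\<close>
  define U where "U X = (if X \<inter> D = {} then monom 1 (card X) * q
    else monom (int (card (X \<inter> D) - 1)) (card X - 1))" for X
  define V where "V Y = (if Y = {} then q else monom (int (card Y - 1)) (card Y - 1))" for Y ::
    "'a set"
  have "q + inverse_KL_rest inverse_KL N = q + (\<Sum>F\<in>Pow ?E - {?E}. U (?E - F))"
  proof -
    have "(if D \<subseteq> F then monom 1 (card (?E - F)) * q
       else monom (int (card (D - F) - 1)) (card (?E - F) - 1)) = U (?E - F)" for F
    proof -
      have "(?E - F) \<inter> D = D - F" using D by auto
      then show ?thesis unfolding U_def by (simp add: Diff_eq_empty_iff)
    qed
    then show ?thesis
      unfolding inverse_KL_rest_subsets[OF N] using summand by (intro arg_cong2[where f = "(+)"]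
        sum.cong) auto
  qed
  also have "\<dots> = (\<Sum>F\<in>Pow ?E. U (?E - F))"
    using fin by (subst sum.remove[where x = ?E]) (auto simp: U_def)
  also have "\<dots> = (\<Sum>X\<in>Pow ?E. U X)"
    by (rule sum.reindex_bij_witness[where i = "\<lambda>X. ?E - X" and j = "\<lambda>X. ?E - X"]) auto
  also have "\<dots> = (\<Sum>(Y, Z)\<in>Pow D \<times> Pow (?E - D). V Y * monom 1 (card Z))"
  proof (rule sum.reindex_bij_witness[where i = "\<lambda>(Y, Z). Y \<union> Z" and j = "\<lambda>X. (X \<inter> D, X - D)"])
    fix X assume X: "X \<in> Pow ?E"
    then have card: "card X = card (X \<inter> D) + card (X - D)" using finF by (simp add: card_Int_Diff)
    show "(case (X \<inter> D, X - D) of (Y, Z) \<Rightarrow> V Y * monom 1 (card Z)) = U X"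
    proof (cases "X \<inter> D = {}")
      case True
      then show ?thesis using card by (simp add: U_def V_def mult.commute)
    next
      case False
      then have "card (X \<inter> D) \<noteq> 0" using finD by simp
      then show ?thesis using False card by (simp add: U_def V_def mult_monom)
    qed
  qed (use D in auto)
  also have "\<dots> = (\<Sum>Y\<in>Pow D. V Y) * (\<Sum>Z\<in>Pow (?E - D). monom 1 (card Z))"
    by (simp add: sum_product sum.cartesian_product)
  also have "(\<Sum>Y\<in>Pow D. V Y) = q + circuit_poly (card D)"
  proof -
    have "(\<Sum>Y\<in>Pow D. V Y) = q + (\<Sum>Y\<in>Pow D - {{}}. V Y)"
      using finD by (subst sum.remove[where x = "{}"]) (auto simp: V_def)
    also have "(\<Sum>Y\<in>Pow D - {{}}. V Y) = (\<Sum>Y\<in>Pow D. monom (int (card Y - 1)) (card Y - 1))"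
      using finD by (intro sum.mono_neutral_cong_left) (auto simp: V_def)
    also have "\<dots> = circuit_poly (card D)"
      unfolding circuit_poly_def by (rule sum_Pow_card[OF finD])
    finally show ?thesis .
  qed
  also have "(\<Sum>Z\<in>Pow (?E - D). monom (1::int) (card Z)) = [:1, 1:] ^ (card ?E - card D)"
    using fin D finD by (simp add: sum_monom_card_Pow card_Diff_subset)
  finally have sum: "q + inverse_KL_rest inverse_KL N =
    [:1, 1:] ^ (card ?E - card D) * (q + circuit_poly (card D))" by (simp only: mult.commute)
  have "card D \<le> card ?E" using D fin by (rule card_mono[rotated])
  then have eq: "matroid_rank N = (card ?E - card D) + (card D - 1)" using rank assms(4) by simp
  show ?case
  proof (rule inverse_KL_eqI[OF N loopless])
    show "0 < matroid_rank N" "2 * degree q < matroid_rank N" using q(1) unfolding eq by auto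
    show "palindromic (matroid_rank N) (q + inverse_KL_rest inverse_KL N)"
      unfolding sum eq by (rule palindromic_linear_power_mult[OF q(2)])
  qed
qed

section \<open>Laguerre's inequality\<close>

text \<open>Splitting off a real root, \<open>p = (x - r) g\<close> gives
  \<open>p'^2 - p p'' = g^2 + (x - r)^2 (g'^2 - g g'')\<close>. Roots of \<open>g\<close> are roots
  of \<open>p\<close>, so induction on the degree makes the last bracket nonnegative.\<close>

lemma Laguerre_inequality:
  fixes p :: "real poly"
  assumes "\<And>z::complex. poly (map_poly of_real p) z = 0 \<Longrightarrow> z \<in> \<real>"
  shows "poly p x * poly (pderiv (pderiv p)) x \<le> (poly (pderiv p) x)\<^sup>2"
  using assms
proof (induction "degree p" arbitrary: p rule: less_induct)
  case less
  show ?case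
  proof (cases "degree p = 0")
    case True
    then show ?thesis by (simp add: pderiv_eq_0_iff[THEN iffD2])
  next
    case False
    then have "degree (map_poly complex_of_real p) \<noteq> 0" by (simp add: degree_map_poly)
    then obtain z where z: "poly (map_poly complex_of_real p) z = 0"
      using fundamental_theorem_of_algebra[of "map_poly complex_of_real p"]
      by (auto simp: constant_degree)
    then obtain r where "z = complex_of_real r" using less.prems Reals_cases by metis
    moreover have "poly (map_poly complex_of_real p) (complex_of_real r) = complex_of_real (poly p
      r)"
      by (induction p) (simp_all add: map_poly_pCons)
    ultimately have "poly p r = 0" using z by simp
    then obtain g where g: "p = [:- r, 1:] * g" by (auto simp: poly_eq_0_iff_dvd)
    then have "g \<noteq> 0" using False by auto
    then have deg: "degree g < degree p" unfolding g by (subst degree_mult_eq) auto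
    have map_poly_g: "map_poly complex_of_real p = [:- of_real r, 1:] * map_poly of_real g"
      unfolding g by (rule poly_eqI) (simp add: coeff_map_poly coeff_pCons split: nat.split)
    have IH: "poly g x * poly (pderiv (pderiv g)) x \<le> (poly (pderiv g) x)\<^sup>2"
    proof (rule less.hyps[OF deg])
      fix z :: complex assume "poly (map_poly of_real g) z = 0"
      then have "poly (map_poly of_real p) z = 0"
        using map_poly_g by simp
      then show "z \<in> \<real>" by (rule less.prems)
    qed
    have "(poly (pderiv p) x)\<^sup>2 - poly p x * poly (pderiv (pderiv p)) x =
      (poly g x)\<^sup>2 + (x - r)\<^sup>2 * ((poly (pderiv g) x)\<^sup>2 - poly g x * poly (pderiv (pderiv g)) x)"
      unfolding g by (simp add: pderiv_mult pderiv_add pderiv_diff pderiv_pCons pderiv_smult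
        power2_eq_square algebra_simps)
    moreover have "0 \<le> \<dots>" using IH by simp
    ultimately show ?thesis by linarith
  qed
qed

section \<open>Duals of rank-two matroids\<close>

text \<open>\<open>cocard\<close> guarantees that deleting one element never leaves all others in
  one block, so the dual is loopless. It also makes each circuit \<open>E - B\<close> large enough
  for \<open>inverse_KL_single_circuit\<close>.\<close>

locale rank_two_partition =
  fixes E :: "'a set" and P :: "'a set set"
  assumes fin: "finite E" and partition: "partition_on E P" and two_blocks: "2 \<le> card P"
    and cocard: "B \<in> P \<Longrightarrow> 2 \<le> card (E - B)"
begin

abbreviation N :: "'a indep_system" where "N \<equiv> rank_two_matroid E P"

abbreviation M :: "'a indep_system" where "M \<equiv> partition_matroid_dual E P"

lemma block_unique: "A \<in> P \<Longrightarrow> B \<in> P \<Longrightarrow> a \<in> A \<Longrightarrow> a \<in> B \<Longrightarrow> A = B"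
  using partition by (auto simp: partition_on_def disjoint_def)

lemma block_subset: "B \<in> P \<Longrightarrow> B \<subseteq> E"
  using partition by (auto simp: partition_on_def)

lemma finite_block: "B \<in> P \<Longrightarrow> finite B"
  using block_subset fin finite_subset by blast

lemma finite_P: "finite P"
  using two_blocks card.infinite by fastforce

lemma block_exists: "a \<in> E \<Longrightarrow> \<exists>B\<in>P. a \<in> B"
  using partition by (auto simp: partition_on_def)

lemma ground_N: "ground N = E"
  by (simp add: rank_two_matroid_eq[OF fin partition two_blocks])

lemma indep_N: "I \<in> indeps N \<longleftrightarrow> I \<subseteq> E \<and> card I \<le> 2 \<and> (\<forall>B\<in>P. \<forall>a\<in>I \<inter> B. \<forall>b\<in>I \<inter> B. a = b)"
  by (simp add: rank_two_matroid_eq[OF fin partition two_blocks])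

lemma is_matroid_N: "is_matroid N" and rank_N: "matroid_rank N = 2"
  using rank_two_matroid_exists[OF fin partition two_blocks]
  by (simp_all add: rank_two_matroid_eq[OF fin partition two_blocks])

lemma finite_indep: "I \<in> indeps N \<Longrightarrow> finite I"
  by (rule indep_finite[OF is_matroid_N])

lemma indep_in_block:
  assumes "B \<in> P" "I \<subseteq> B"
  shows "I \<in> indeps N \<longleftrightarrow> card I \<le> 1"
proof
  have fI: "finite I" using assms finite_block finite_subset by blast
  show "card I \<le> 1" if "I \<in> indeps N"
  proof -
    have "\<forall>a\<in>I \<inter> B. \<forall>b\<in>I \<inter> B. a = b" using that assms(1) unfolding indep_N by blast
    then have "\<forall>a\<in>I. \<forall>b\<in>I. a = b" using assms(2) by blast
    then show ?thesis using card_le_Suc0_iff_eq[OF fI] by simp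
  qed
  show "I \<in> indeps N" if "card I \<le> 1"
  proof -
    have "\<forall>a\<in>I. \<forall>b\<in>I. a = b" using that card_le_Suc0_iff_eq[OF fI] by simp
    then show ?thesis using that assms(2) block_subset[OF assms(1)] unfolding indep_N by fastforce
  qed
qed

lemma rk_block:
  assumes "B \<in> P" "C \<subseteq> B" "C \<noteq> {}"
  shows "rk N C = 1"
proof -
  obtain I where I: "I \<in> indeps N" "I \<subseteq> C" "card I = rk N C"
    using basis_exists[OF is_matroid_N] .
  then have "rk N C \<le> 1" using indep_in_block[OF assms(1), of I] assms(2) by auto
  moreover obtain c where c: "c \<in> C" using assms(3) by blast
  then have "card {c} \<le> rk N C"
    using assms indep_in_block[OF assms(1), of "{c}"] by (intro card_le_rk[OF is_matroid_N]) auto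
  ultimately show ?thesis by simp
qed

lemma rk_eq_2_iff:
  assumes "C \<subseteq> E" "C \<noteq> {}"
  shows "rk N C = 2 \<longleftrightarrow> \<not> (\<exists>B\<in>P. C \<subseteq> B)"
proof
  show "\<not> (\<exists>B\<in>P. C \<subseteq> B)" if "rk N C = 2"
  proof
    assume "\<exists>B\<in>P. C \<subseteq> B"
    then have "rk N C = 1" using rk_block assms(2) by blast
    then show False using that by simp
  qed
next
  assume nb: "\<not> (\<exists>B\<in>P. C \<subseteq> B)"
  obtain a where a: "a \<in> C" using assms(2) by blast
  then obtain A where A: "A \<in> P" "a \<in> A" using block_exists assms(1) by blast
  obtain b where b: "b \<in> C" "b \<notin> A" using nb A(1) by blast
  have "{a, b} \<in> indeps N"
    using a b A assms(1) block_unique[OF A(1)] by (auto simp: indep_N card_insert_if)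
  then have "card {a, b} \<le> rk N C" using a b by (intro card_le_rk[OF is_matroid_N]) auto
  moreover have "rk N C \<le> 2"
    using basis_exists[OF is_matroid_N, of C] by (metis indep_N)
  ultimately show "rk N C = 2" using A b by (simp add: card_insert_if split: if_splits)
qed

lemma M_eq: "M = matroid_dual N"
  by (simp add: partition_matroid_dual_def)

lemma is_matroid_M: "is_matroid M"
  unfolding M_eq by (rule is_matroid_dual[OF is_matroid_N])

lemma rank_M: "matroid_rank M = card E - 2"
proof -
  have "matroid_rank M + matroid_rank N = card E + rk N {}"
    using rk_dual[OF is_matroid_N, of E] by (simp add: M_eq matroid_rank_def ground_N)
  moreover have "rk N {} = 0" using rk_le_card[OF is_matroid_N, of "{}"] by simp
  ultimately show ?thesis using rank_N by simp
qed

lemma indep_M: "I \<in> indeps M \<longleftrightarrow> I \<subseteq> E \<and> rk N (E - I) = 2"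
  unfolding M_eq matroid_dual_indep_iff[OF is_matroid_N] ground_N rank_N ..

lemma loopless_M: "loopless M"
proof -
  have "{e} \<in> indeps M" if e: "e \<in> E" for e
  proof -
    have "\<not> E - {e} \<subseteq> B" if B: "B \<in> P" for B
    proof
      assume "E - {e} \<subseteq> B"
      then have "E - B \<subseteq> {e}" by blast
      then have "card (E - B) \<le> card {e}" by (intro card_mono) auto
      then show False using cocard[OF B] by simp
    qed
    moreover from this have "E - {e} \<noteq> {}" using block_exists[OF e] by auto
    ultimately show ?thesis using e by (auto simp: indep_M rk_eq_2_iff)
  qed
  then show ?thesis by (simp add: loopless_def M_eq ground_N)
qed

text \<open>The complement of any subset of \<open>E - C\<close> contains \<open>C\<close>, which
  spans \<open>N\<close>; hence every such subset is independent in \<open>M\<close>.\<close>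

lemma inverse_KL_restrict_independent:
  assumes C: "C \<subseteq> E" "rk N C = 2"
  shows "inverse_KL (matroid_restrict M (E - C)) = 1"
proof (rule inverse_KL_Boolean)
  have "rk N (E - I) = 2" if "I \<subseteq> E - C" for I
  proof -
    have "rk N C \<le> rk N (E - I)" "rk N (E - I) \<le> rk N E"
      using that C(1) by (auto intro!: rk_mono[OF is_matroid_N])
    then show ?thesis using C(2) rank_N by (simp add: matroid_rank_def ground_N)
  qed
  then show "indeps (matroid_restrict M (E - C)) = Pow (ground (matroid_restrict M (E - C)))"
    by (auto simp: matroid_restrict_def indep_M)
qed (simp add: matroid_restrict_def fin)

lemma inverse_KL_restrict_block:
  assumes B: "B \<in> P" and C: "C \<subseteq> B" "C \<noteq> {}"
    and q: "2 * degree q < card (E - B) - 1"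
      "palindromic (card (E - B) - 1) (q + circuit_poly (card (E - B)))"
  shows "inverse_KL (matroid_restrict M (E - C)) = q"
proof (rule inverse_KL_single_circuit[where D = "E - B"])
  have "rk N (E - I) = 2 \<longleftrightarrow> \<not> E - B \<subseteq> I" if I: "I \<subseteq> E - C" for I
  proof -
    have sub: "C \<subseteq> E - I" using I C(1) block_subset[OF B] by blast
    \<comment> \<open>\<open>E - I\<close> contains the nonempty \<open>C\<close>, so
      \<open>B\<close> is the only block that can contain it, and it does so exactly when
      \<open>I\<close> contains \<open>E - B\<close>. The circuit is thus the same for all
      \<open>C\<close> inside \<open>B\<close>.\<close>
    have "(\<exists>B'\<in>P. E - I \<subseteq> B') \<longleftrightarrow> E - I \<subseteq> B"
      using sub C B block_unique[OF B] by blast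
    then show ?thesis using sub C(2) by (subst rk_eq_2_iff) auto
  qed
  then show "indeps (matroid_restrict M (E - C)) =
      {I. I \<subseteq> ground (matroid_restrict M (E - C)) \<and> \<not> E - B \<subseteq> I}"
    by (auto simp: matroid_restrict_def indep_M)
qed (use C q cocard[OF B] fin in \<open>auto simp: matroid_restrict_def\<close>)

text \<open>By \<open>spanning_sum_dual\<close> this is, up to the sign
  \<open>(-1) ^ card C\<close>, the Moebius weight of \<open>E - C\<close> in
  \<open>M\<close>.\<close>

definition alt_count :: "'a set \<Rightarrow> int" where
  "alt_count C = (\<Sum>J | J \<in> indeps N \<and> J \<subseteq> C. (-1) ^ card J)"

lemma finite_indeps_N: "finite (indeps N)"
  by (rule finite_indeps[OF is_matroid_N])

lemma alt_count_block:
  assumes "B \<in> P" "C \<subseteq> B"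
  shows "alt_count C = 1 - int (card C)"
proof -
  have finC: "finite C" using assms finite_block finite_subset by blast
  have "{J. J \<in> indeps N \<and> J \<subseteq> C} = insert {} ((\<lambda>c. {c}) ` C)"
  proof (intro equalityI subsetI)
    fix J assume J: "J \<in> {J. J \<in> indeps N \<and> J \<subseteq> C}"
    then have "card J \<le> 1" "finite J" using indep_in_block[OF assms(1), of J] assms(2)
      finite_indep by auto
    then consider "J = {}" | c where "J = {c}" by (metis One_nat_def card_1_singletonE card_0_eq
      le_Suc_eq le_zero_eq)
    then show "J \<in> insert {} ((\<lambda>c. {c}) ` C)" using J by cases auto
  next
    fix J assume "J \<in> insert {} ((\<lambda>c. {c}) ` C)"
    then have "J \<subseteq> C" "card J \<le> 1" by auto
    then show "J \<in> {J. J \<in> indeps N \<and> J \<subseteq> C}" using indep_in_block[OF assms(1), of J] assms(2) by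
      auto
  qed
  moreover have "{} \<notin> (\<lambda>c. {c}) ` C" by auto
  moreover have "(\<Sum>J\<in>(\<lambda>c. {c}) ` C. (-1::int) ^ card J) = - int (card C)"
    by (subst sum.reindex) auto
  ultimately show ?thesis unfolding alt_count_def using finC by simp
qed

text \<open>The number of bases of \<open>N\<close>, that is, of pairs from different
  blocks.\<close>

definition pair_count :: int where
  "pair_count = int (card E choose 2) - (\<Sum>B\<in>P. int (card B choose 2))"

lemma card_indeps_2: "int (card {J \<in> indeps N. card J = 2}) = pair_count"
proof -
  let ?K = "\<lambda>X. {J. J \<subseteq> X \<and> card J = 2}"
  have "{J \<in> indeps N. card J = 2} = ?K E - (\<Union>B\<in>P. ?K B)"
  proof (intro equalityI subsetI)
    fix J assume J: "J \<in> {J \<in> indeps N. card J = 2}"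
    then have "\<not> J \<subseteq> B" if "B \<in> P" for B using indep_in_block[OF that, of J] by auto
    then show "J \<in> ?K E - (\<Union>B\<in>P. ?K B)" using J by (auto simp: indep_N)
  next
    fix J assume J: "J \<in> ?K E - (\<Union>B\<in>P. ?K B)"
    then obtain a b where ab: "J = {a, b}" "a \<noteq> b" by (auto simp: card_2_iff)
    then have "\<not> (a \<in> B \<and> b \<in> B)" if "B \<in> P" for B using J that by auto
    then show "J \<in> {J \<in> indeps N. card J = 2}" using J ab by (auto simp: indep_N)
  qed
  moreover have "(\<Union>B\<in>P. ?K B) \<subseteq> ?K E" using block_subset by blast
  moreover have "finite (\<Union>B\<in>P. ?K B)" "finite (?K E)" using finite_P finite_block fin by auto
  moreover have "card (\<Union>B\<in>P. ?K B) = (\<Sum>B\<in>P. card (?K B))"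
  proof (rule card_UN_disjoint[OF finite_P])
    show "\<forall>A\<in>P. \<forall>B\<in>P. A \<noteq> B \<longrightarrow> ?K A \<inter> ?K B = {}"
    proof (intro ballI impI equals0I)
      fix A B J assume "A \<in> P" "B \<in> P" "A \<noteq> B" "J \<in> ?K A \<inter> ?K B"
      moreover from this have "J \<noteq> {}" by auto
      ultimately show False using block_unique by blast
    qed
  qed (use finite_block in auto)
  ultimately have "card {J \<in> indeps N. card J = 2} = card (?K E) - (\<Sum>B\<in>P. card (?K B))"
    "(\<Sum>B\<in>P. card (?K B)) \<le> card (?K E)"
    using card_Diff_subset[of "\<Union>B\<in>P. ?K B" "?K E"] card_mono[of "?K E" "\<Union>B\<in>P. ?K B"]
    by simp_all
  then have "int (card {J \<in> indeps N. card J = 2}) = int (card (?K E)) - (\<Sum>B\<in>P. int (card (?K B)))"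
    by (simp add: of_nat_diff)
  also have "\<dots> = pair_count"
    unfolding pair_count_def using fin finite_block by (simp add: n_subsets)
  finally show ?thesis .
qed

lemma sum_indeps_card:
  fixes f :: "nat \<Rightarrow> int poly"
  shows "(\<Sum>J\<in>indeps N. f (card J)) = f 0 + of_nat (card E) * f 1 + of_int pair_count * f 2"
proof -
  have card_0: "{J \<in> indeps N. card J = 0} = {{}}"
    using finite_indep indep_empty[OF is_matroid_N] by auto
  have card_1: "{J \<in> indeps N. card J = 1} = {J. J \<subseteq> E \<and> card J = 1}"
  proof (intro equalityI subsetI)
    fix J assume J: "J \<in> {J. J \<subseteq> E \<and> card J = 1}"
    then obtain a where a: "J = {a}" "a \<in> E" by (auto simp: card_1_singleton_iff)
    then obtain B where "B \<in> P" "a \<in> B" using block_exists by blast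
    then show "J \<in> {J \<in> indeps N. card J = 1}" using a indep_in_block[of B J] by simp
  qed (use indep_subset[OF is_matroid_N] in \<open>auto simp: ground_N\<close>)
  have "(\<Sum>J\<in>indeps N. f (card J)) = (\<Sum>k\<le>2. (\<Sum>J\<in>{J \<in> indeps N. card J = k}. f (card J)))"
    using finite_indeps_N by (intro sum.group[symmetric]) (auto simp: indep_N)
  also have "\<dots> = (\<Sum>k\<le>2. of_nat (card {J \<in> indeps N. card J = k}) * f k)" by simp
  also have "\<dots> = of_nat (card {J \<in> indeps N. card J = 0}) * f 0
      + of_nat (card {J \<in> indeps N. card J = 1}) * f 1
      + of_int (int (card {J \<in> indeps N. card J = 2})) * f 2"
    by (simp add: numeral_2_eq_2)
  also have "\<dots> = f 0 + of_nat (card E) * f 1 + of_int pair_count * f 2"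
    unfolding card_indeps_2 card_0 card_1 using fin by (simp add: n_subsets)
  finally show ?thesis .
qed

text \<open>After exchanging the sums, an independent \<open>J\<close> collects all sets
  \<open>C\<close> above it and contributes
  \<open>(-1) ^ card J * x ^ card J * (1 + x) ^ (card E - card J)\<close>. The three terms belong to
  the sizes 0, 1 and 2 of \<open>J\<close>.\<close>

lemma sum_alt_count:
  "(\<Sum>C\<in>Pow E. monom (alt_count C) (card C)) =
     [:1, 1:] ^ card E - of_nat (card E) * monom 1 1 * [:1, 1:] ^ (card E - 1)
     + of_int pair_count * monom 1 2 * [:1, 1:] ^ (card E - 2)"
proof -
  have "(\<Sum>C\<in>Pow E. monom (alt_count C) (card C)) =
      (\<Sum>C\<in>Pow E. \<Sum>J | J \<in> indeps N \<and> J \<subseteq> C. monom ((-1) ^ card J) (card C))"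
    by (simp add: alt_count_def monom_sum)
  also have "\<dots> = (\<Sum>J\<in>indeps N. \<Sum>C | C \<in> Pow E \<and> J \<subseteq> C. monom ((-1) ^ card J) (card C))"
    using fin finite_indeps_N by (intro sum.swap_restrict) auto
  also have "\<dots> = (\<Sum>J\<in>indeps N. monom ((-1) ^ card J) (card J) * [:1, 1:] ^ (card E - card J))"
  proof (rule sum.cong)
    fix J assume J: "J \<in> indeps N"
    then have "J \<subseteq> E" by (simp add: indep_N)
    have "(\<Sum>C | C \<in> Pow E \<and> J \<subseteq> C. monom ((-1::int) ^ card J) (card C)) =
        (\<Sum>C | J \<subseteq> C \<and> C \<subseteq> E. monom ((-1) ^ card J) 0 * monom 1 (card C))"
      by (intro sum.cong) (auto simp: mult_monom)
    also have "\<dots> = monom ((-1) ^ card J) (card J) * [:1, 1:] ^ (card E - card J)"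
      unfolding sum_distrib_left[symmetric] sum_monom_card_superset[OF fin \<open>J \<subseteq> E\<close>]
      by (simp add: mult_monom flip: mult.assoc)
    finally show "(\<Sum>C | C \<in> Pow E \<and> J \<subseteq> C. monom ((-1::int) ^ card J) (card C)) =
      monom ((-1) ^ card J) (card J) * [:1, 1:] ^ (card E - card J)" .
  qed simp
  also have "\<dots> = [:1, 1:] ^ card E - of_nat (card E) * monom 1 1 * [:1, 1:] ^ (card E - 1)
     + of_int pair_count * monom 1 2 * [:1, 1:] ^ (card E - 2)"
    by (subst sum_indeps_card) (simp add: monom_0 flip: minus_monom)
  finally show ?thesis .
qed

text \<open>The factor \<open>x\<^sup>2\<close> clears the exponents \<open>card C - 2\<close> coming from the sets \<open>C\<close> of rank 2.\<close>

lemma inverse_KL_rest_M: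
  assumes q: "\<And>B. B \<in> P \<Longrightarrow> 2 * degree (q B) < card (E - B) - 1"
      "\<And>B. B \<in> P \<Longrightarrow> palindromic (card (E - B) - 1) (q B + circuit_poly (card (E - B)))"
  shows "monom 1 2 * inverse_KL_rest inverse_KL M =
    [:1, 1:] ^ card E - of_nat (card E) * monom 1 1 * [:1, 1:] ^ (card E - 1)
    + of_int pair_count * monom 1 2 * [:1, 1:] ^ (card E - 2) - 1
    + (\<Sum>B\<in>P. monom 1 1 * circuit_poly (card B) * (1 + monom 1 1 * q B))"
proof -
  \<comment> \<open>The uniform term \<open>alt_count C * x ^ card C\<close> is correct for
    \<open>C\<close> of rank 2. For \<open>C\<close> inside a block \<open>B\<close> the true term
    is \<open>T C * x * q B\<close>, while the uniform one equals \<open>- T C\<close>; the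
    correction is therefore \<open>T C * (1 + x * q B)\<close>.\<close>
  define T where "T C = monom (int (card C - 1)) (card C)" for C :: "'a set"
  have summand: "monom 1 2 * (monom ((-1) ^ rk N C * alt_count C) (card C - rk N C)
      * inverse_KL (matroid_restrict M (E - C))) =
    monom (alt_count C) (card C) + (\<Sum>B\<in>P. if C \<subseteq> B then T C * (1 + monom 1 1 * q B) else 0)"
    if C: "C \<in> Pow E - {{}}" for C
  proof (cases "\<exists>B\<in>P. C \<subseteq> B")
    case True
    then obtain B where B: "B \<in> P" "C \<subseteq> B" by blast
    have finC: "finite C" using C fin finite_subset by blast
    then obtain k where k: "card C = Suc k" using C by (metis card_0_eq Diff_iff insertI1
      not0_implies_Suc)
    have "(\<Sum>B'\<in>P. if C \<subseteq> B' then T C * (1 + monom 1 1 * q B') else 0) =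
        (\<Sum>B'\<in>P. if B' = B then T C * (1 + monom 1 1 * q B') else 0)"
    proof (rule sum.cong)
      fix B' assume "B' \<in> P"
      then have "C \<subseteq> B' \<longleftrightarrow> B' = B" using B C block_unique[of B' B] by blast
      then show "(if C \<subseteq> B' then T C * (1 + monom 1 1 * q B') else 0) =
        (if B' = B then T C * (1 + monom 1 1 * q B') else 0)" by simp
    qed simp
    also have "\<dots> = T C * (1 + monom 1 1 * q B)" using B(1) finite_P by simp
    finally have "(\<Sum>B'\<in>P. if C \<subseteq> B' then T C * (1 + monom 1 1 * q B') else 0) =
      T C * (1 + monom 1 1 * q B)" .
    moreover have "inverse_KL (matroid_restrict M (E - C)) = q B"
      using B C q by (intro inverse_KL_restrict_block) auto
    moreover have "rk N C = 1" using B C by (intro rk_block) auto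
    moreover have "monom (alt_count C) (card C) + T C = 0"
      by (simp add: T_def alt_count_block[OF B] k add_monom)
    moreover have "monom 1 2 * monom (- alt_count C) (card C - 1) = T C * monom 1 1"
      by (simp add: T_def alt_count_block[OF B] k mult_monom)
    ultimately show ?thesis by (simp add: distrib_left mult.assoc[symmetric] add.assoc[symmetric])
  next
    case False
    then have rk: "rk N C = 2" using C by (subst rk_eq_2_iff) auto
    have "card C \<ge> 2" using rk_le_card[OF is_matroid_N, of C] C fin rk finite_subset by fastforce
    then have "2 + (card C - 2) = card C" by simp
    then have "monom 1 2 * monom (alt_count C) (card C - 2) = monom (alt_count C) (card C)"
      unfolding mult_monom by simp
    moreover have "inverse_KL (matroid_restrict M (E - C)) = 1"
      using C rk by (intro inverse_KL_restrict_independent) auto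
    moreover have "(\<Sum>B\<in>P. if C \<subseteq> B then T C * (1 + monom 1 1 * q B) else 0) = 0"
      using False by (intro sum.neutral) auto
    ultimately show ?thesis by (simp add: rk)
  qed
  have "monom 1 2 * inverse_KL_rest inverse_KL M = (\<Sum>C\<in>Pow E - {{}}.
      monom 1 2 * (monom ((-1) ^ rk N C * alt_count C) (card C - rk N C)
      * inverse_KL (matroid_restrict M (E - C))))"
    unfolding M_eq inverse_KL_rest_dual[OF is_matroid_N] alt_count_def ground_N
    by (rule sum_distrib_left)
  also have "\<dots> = (\<Sum>C\<in>Pow E - {{}}. monom (alt_count C) (card C)
      + (\<Sum>B\<in>P. if C \<subseteq> B then T C * (1 + monom 1 1 * q B) else 0))"
    using summand by (intro sum.cong) auto
  also have "\<dots> = (\<Sum>C\<in>Pow E - {{}}. monom (alt_count C) (card C))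
      + (\<Sum>B\<in>P. \<Sum>C\<in>Pow E - {{}}. if C \<subseteq> B then T C * (1 + monom 1 1 * q B) else 0)"
    unfolding sum.distrib by (subst (2) sum.swap) (rule refl)
  also have "(\<Sum>C\<in>Pow E - {{}}. monom (alt_count C) (card C)) = (\<Sum>C\<in>Pow E. monom (alt_count C)
    (card C)) - 1"
  proof -
    have "{J. J \<in> indeps N \<and> J \<subseteq> {}} = {{}}" by (auto simp: indep_N)
    then have "alt_count {} = 1" by (simp add: alt_count_def)
    then show ?thesis using fin by (simp add: sum_diff1 monom_0 one_pCons)
  qed
  also have "(\<Sum>B\<in>P. \<Sum>C\<in>Pow E - {{}}. if C \<subseteq> B then T C * (1 + monom 1 1 * q B) else 0) =
      (\<Sum>B\<in>P. monom 1 1 * circuit_poly (card B) * (1 + monom 1 1 * q B))"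
  proof (rule sum.cong)
    fix B assume B: "B \<in> P"
    \<comment> \<open>The empty set may join the sum: \<open>0 - 1\<close> is truncated, so
      \<open>T {} = 0\<close>.\<close>
    have "(\<Sum>C\<in>Pow E - {{}}. if C \<subseteq> B then T C * (1 + monom 1 1 * q B) else 0) =
        (\<Sum>C\<in>Pow B. T C * (1 + monom 1 1 * q B))"
      using fin block_subset[OF B] by (intro sum.mono_neutral_cong) (auto simp: T_def finite_subset)
    also have "\<dots> = (\<Sum>C\<in>Pow B. T C) * (1 + monom 1 1 * q B)" by (simp add: sum_distrib_right)
    also have "(\<Sum>C\<in>Pow B. T C) = monom 1 1 * circuit_poly (card B)"
    proof -
      have "monom (int (k - 1)) k = monom 1 1 * monom (int (k - 1)) (k - 1)" for k
        by (cases k) (simp_all add: mult_monom)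
      then show ?thesis
        unfolding circuit_poly_def T_def using sum_Pow_card[OF finite_block[OF B], of "\<lambda>k. monom
          (int (k - 1)) k"]
        by (simp add: sum_distrib_left mult.left_commute)
    qed
    finally show "(\<Sum>C\<in>Pow E - {{}}. if C \<subseteq> B then T C * (1 + monom 1 1 * q B) else 0) =
      monom 1 1 * circuit_poly (card B) * (1 + monom 1 1 * q B)" .
  qed simp
  finally show ?thesis unfolding sum_alt_count by (simp only: algebra_simps)
qed

end

section \<open>The partition of type (4, 4, 4, 3, 3, 3)\<close>

text \<open>Turns the symmetry of an explicit polynomial into a reversal test on a literal list,
  which simplification decides.\<close>

lemma palindromic_Poly:
  assumes "rev xs = xs" "length xs = Suc d"
  shows "palindromic d (Poly xs)"
  unfolding palindromic_def
proof (intro conjI allI impI)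
  show "degree (Poly xs) \<le> d"
    by (rule degree_le) (use assms(2) in \<open>simp add: nth_default_def\<close>)
  fix i assume "i \<le> d"
  then have "rev xs ! i = xs ! (d - i)" using assms(2) by (simp add: rev_nth)
  then show "coeff (Poly xs) i = coeff (Poly xs) (d - i)"
    using \<open>i \<le> d\<close> assms by (simp add: nth_default_def)
qed

section \<open>Explicit circuit polynomials\<close>

lemma circuit_poly_3: "circuit_poly 3 = [:0, 3, 2:]"
  by (simp add: circuit_poly_def eval_nat_numeral monom_Suc monom_0 numeral_poly one_pCons)

lemma circuit_poly_4: "circuit_poly 4 = [:0, 6, 8, 3:]"
  by (simp add: circuit_poly_def eval_nat_numeral monom_Suc monom_0 numeral_poly one_pCons)

text \<open>Applying \<open>x d/dx - 1\<close> to the expansion of \<open>(1 + x) ^ m\<close> gives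
  the term of degree k the weight k - 1. The final \<open>+ 1\<close> repairs k = 0, where
  truncation makes the weight 0 instead of -1. This closed form is what gets expanded for the
  circuits of size 17 and 18.\<close>

lemma x_circuit_poly:
  "monom 1 1 * circuit_poly m = of_nat m * monom 1 1 * [:1, 1:] ^ (m - 1) - [:1, 1:] ^ m + 1"
proof -
  have deriv: "of_nat m * monom 1 1 * [:1, 1:] ^ (m - 1) = monom 1 1 * pderiv ([:1, 1::int:] ^ m)"
    by (cases m) (simp_all add: pderiv_power_Suc pderiv_pCons of_nat_poly smult_add_left
      algebra_simps del: power_Suc)
  have summand: "monom 1 1 * (of_nat c * monom (int (k - 1)) (k - 1)) =
      monom 1 1 * pderiv (of_nat c * monom (1::int) k) - of_nat c * monom 1 k + (if k = 0 then
        of_nat c else 0)"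
    for c k
    by (cases k) (simp_all add: pderiv_mult pderiv_monom mult_monom algebra_simps monom_0 one_pCons
        flip: add_monom)
  have "monom 1 1 * circuit_poly m = (\<Sum>k\<le>m. monom 1 1 * pderiv (of_nat (m choose k) * monom 1 k)
      - of_nat (m choose k) * monom 1 k + (if k = 0 then of_nat (m choose k) else 0))"
    unfolding circuit_poly_def sum_distrib_left summand ..
  also have "\<dots> = monom 1 1 * pderiv ([:1, 1:] ^ m) - [:1, 1:] ^ m + 1"
    unfolding linear_power_eq_sum by (simp add: sum.distrib sum_subtractf higher_pderiv_sum[of 1,
      simplified] sum_distrib_left)
  finally show ?thesis unfolding deriv .
qed

text \<open>A circuit of 17 elements has rank 16. For i up to 7, coefficient i of the first summand
  is what coefficient i of \<open>circuit_poly 17\<close> lacks compared with coefficient 16 -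
  i.\<close>

lemma circuit_17_palindrome:
  "[:16, 119, 544, 1700, 3808, 6188, 7072, 4862:] + circuit_poly 17 =
    Poly [16, 255, 1904, 8840, 28560, 68068, 123760, 175032, 194480, 175032, 123760, 68068, 28560,
      8840, 1904, 255, 16]"
proof -
  have "monom 1 1 * circuit_poly 17 = monom 1 1 * [:0, 136, 1360, 7140, 24752, 61880, 116688,
    170170, 194480, 175032, 123760, 68068, 28560, 8840, 1904, 255, 16:]"
    unfolding x_circuit_poly by (simp add: eval_nat_numeral monom_Suc monom_0 numeral_poly
      one_pCons)
  then have "circuit_poly 17 = [:0, 136, 1360, 7140, 24752, 61880, 116688, 170170, 194480, 175032,
    123760, 68068, 28560, 8840, 1904, 255, 16:]" by (simp add: monom_Suc monom_0)
  then show ?thesis by simp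
qed

text \<open>The same completion in rank 17, for i up to 8; the odd rank leaves no middle
  coefficient.\<close>

lemma circuit_18_palindrome:
  "[:17, 135, 663, 2244, 5508, 9996, 13260, 11934, 4862:] + circuit_poly 18 =
    Poly [17, 288, 2295, 11424, 39780, 102816, 204204, 318240, 393822, 393822, 318240, 204204,
      102816, 39780, 11424, 2295, 288, 17]"
proof -
  have "monom 1 1 * circuit_poly 18 = monom 1 1 * [:0, 153, 1632, 9180, 34272, 92820, 190944,
    306306, 388960, 393822, 318240, 204204, 102816, 39780, 11424, 2295, 288, 17:]"
    unfolding x_circuit_poly by (simp add: eval_nat_numeral monom_Suc monom_0 numeral_poly
      one_pCons)
  then have "circuit_poly 18 = [:0, 153, 1632, 9180, 34272, 92820, 190944, 306306, 388960, 393822,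
    318240, 204204, 102816, 39780, 11424, 2295, 288, 17:]" by (simp add: monom_Suc monom_0)
  then show ?thesis by simp
qed

theorem theorem5p3:
  fixes P :: "nat set set"
  assumes "partition_on {1..21} P"
    and "image_mset card (mset_set P) = {#4, 4, 4, 3, 3, 3#}"
  shows "\<not> real_rooted (binomial_normalization (inverse_KL (partition_matroid_dual {1..21} P)))"
proof -
  have finP: "finite P" using assms(1) by (rule finite_elements[rotated]) simp
  have "card P = size (image_mset card (mset_set P))" by simp
  then have card_P: "card P = 6" unfolding assms(2) by simp
  have block: "card B = 3 \<or> card B = 4" "finite B" "B \<subseteq> {1..21}" if "B \<in> P" for B
  proof -
    have "card B \<in># image_mset card (mset_set P)" using that finP by simp
    then show "card B = 3 \<or> card B = 4" unfolding assms(2) by auto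
    then show "finite B" using card.infinite by fastforce
    show "B \<subseteq> {1..21}" using that assms(1) by (auto simp: partition_on_def)
  qed
  have sum_P: "(\<Sum>B\<in>P. f (card B)) = 3 * f 4 + 3 * f 3" for f :: "nat \<Rightarrow> 'b::comm_ring_1"
  proof -
    have "(\<Sum>B\<in>P. f (card B)) = (\<Sum>k\<in>#image_mset card (mset_set P). f k)"
      by (simp add: sum_unfold_sum_mset image_mset.compositionality comp_def)
    then show ?thesis unfolding assms(2) by (simp add: algebra_simps)
  qed
  have card_compl: "card ({1..21} - B) = 21 - card B" if "B \<in> P" for B
    using block[OF that] by (simp add: card_Diff_subset)
  interpret rank_two_partition "{1..21}" P
    by unfold_locales (use assms(1) card_P in simp_all, use card_compl block(1) in fastforce)
  \<comment> \<open>Indexed by the size of the block: its complement is a circuit of 17 elements for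
    size 4 and of 18 for size 3.\<close>
  define q :: "nat \<Rightarrow> int poly" where "q b = (if b = 4
    then [:16, 119, 544, 1700, 3808, 6188, 7072, 4862:]
    else [:17, 135, 663, 2244, 5508, 9996, 13260, 11934, 4862:])" for b
  \<comment> \<open>Of the 210 pairs, each block of size 4 excludes 6 and each block of size 3
    excludes 3.\<close>
  have pair_count: "pair_count = 183"
    unfolding pair_count_def using sum_P[of "\<lambda>b. int (b choose 2)"] by (simp add: choose_two)
  have rest: "monom 1 2 * inverse_KL_rest inverse_KL M =
    [:1, 1:] ^ 21 - 21 * monom 1 1 * [:1, 1:] ^ 20 + 183 * monom 1 2 * [:1, 1:] ^ 19 - 1
    + (\<Sum>B\<in>P. monom 1 1 * circuit_poly (card B) * (1 + monom 1 1 * q (card B)))"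
  proof -
    have "2 * degree (q (card B)) < card ({1..21} - B) - 1"
      "palindromic (card ({1..21} - B) - 1) (q (card B) + circuit_poly (card ({1..21} - B)))"
      if B: "B \<in> P" for B
    proof -
      show "2 * degree (q (card B)) < card ({1..21} - B) - 1"
        using block(1)[OF B] unfolding card_compl[OF B] by (auto simp: q_def)
      show "palindromic (card ({1..21} - B) - 1) (q (card B) + circuit_poly (card ({1..21} - B)))"
        using block(1)[OF B] unfolding card_compl[OF B]
      proof
        assume "card B = 3"
        then show "palindromic (21 - card B - 1) (q (card B) + circuit_poly (21 - card B))"
          by (simp add: q_def circuit_18_palindrome palindromic_Poly del: Poly.simps)
      next
        assume "card B = 4"
        then show "palindromic (21 - card B - 1) (q (card B) + circuit_poly (21 - card B))"
          by (simp add: q_def circuit_17_palindrome palindromic_Poly del: Poly.simps)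
      qed
    qed
    from inverse_KL_rest_M[of "\<lambda>B. q (card B)", OF this] show ?thesis
      unfolding pair_count by simp
  qed
  \<comment> \<open>For i up to 9, coefficient i is the difference of the coefficients 19 - i and i
    in \<open>rest_eq\<close>; for instance 1790 = 3078 - 1288.\<close>
  let ?Q = "[:163, 1790, 10323, 39217, 106659, 215169, 323646, 350404, 232662, 71162:] :: int poly"
  have "monom 1 2 * inverse_KL_rest inverse_KL M = monom 1 2 *
    [:0, 1288, 17190, 115500, 506889, 1607520, 3881814, 7358960, 11156964, 13673712, 13744874,
      11389626, 7709364, 4205460, 1822689, 613548, 154717, 27513, 3078, 163:]"
    unfolding rest
      sum_P[of "\<lambda>b. monom 1 1 * circuit_poly b * (1 + monom 1 1 * q b)"]
    unfolding circuit_poly_3 circuit_poly_4 q_def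
    by (simp add: eval_nat_numeral monom_Suc monom_0 numeral_poly one_pCons)
  then have rest_eq: "inverse_KL_rest inverse_KL M =
    [:0, 1288, 17190, 115500, 506889, 1607520, 3881814, 7358960, 11156964, 13673712, 13744874,
      11389626, 7709364, 4205460, 1822689, 613548, 154717, 27513, 3078, 163:]"
    by (simp add: eval_nat_numeral monom_Suc monom_0)
  have rank: "matroid_rank M = 19" unfolding rank_M by simp
  have KL: "inverse_KL M = ?Q"
  proof (rule inverse_KL_eqI[OF is_matroid_M loopless_M])
    have "?Q + inverse_KL_rest inverse_KL M =
      Poly [163, 3078, 27513, 154717, 613548, 1822689, 4205460, 7709364, 11389626, 13744874,
        13744874, 11389626, 7709364, 4205460, 1822689, 613548, 154717, 27513, 3078, 163]"
      unfolding rest_eq by simp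
    then show "palindromic (matroid_rank M) (?Q + inverse_KL_rest inverse_KL M)"
      unfolding rank by (simp only:) (rule palindromic_Poly; simp)
  qed (simp_all only: rank, simp_all)
  \<comment> \<open>The degree of \<open>?Q\<close> is 9, so its coefficients are multiplied by 1,
    9, 36, 84, 126, 126, 84, 36, 9, 1.\<close>
  let ?B = "[:163, 16110, 371628, 3294228, 13439034, 27111294, 27186264, 12614544, 2093958, 71162:]"
  have norm: "binomial_normalization ?Q = ?B"
    by (simp add: binomial_normalization_def eval_nat_numeral monom_Suc monom_0)
  show ?thesis
  proof
    assume "real_rooted (binomial_normalization (inverse_KL M))"
    then have real: "z \<in> \<real>" if "poly (map_poly of_int ?B) z = 0" for z :: complex
      using that unfolding KL norm real_rooted_def by blast
    let ?p = "?B :: real poly"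
    \<comment> \<open>At -1 the polynomial and its first two derivatives take the values -16291,
      28890 and -2064528. The product of the outer two is about 40 times the square of the middle
      one.\<close>
    have "poly ?p (-1) * poly (pderiv (pderiv ?p)) (-1) \<le> (poly (pderiv ?p) (-1))\<^sup>2"
      by (rule Laguerre_inequality) (rule real, simp add: map_poly_pCons)
    then show False by (simp add: pderiv_pCons)
  qed
qed

end
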